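(* Let $f_1(x_1,\dots,x_n),\dots,f_l(x_1,\dots,x_n)$ be real analytic (real-valued) functions on a neighborhood of the origin in $\mathbb{R}^n$, none identically zero. Then there are an $\eta>0$ and a positive integer $p$ such that for all $s_1,\dots,s_l\in\mathbb{R}$ and each $(x_1,\dots,x_{n-1})\in B_{n-1}(0,\eta)$, the set $$\{x_n: |x_n|<\eta \text{ and } f_i(x_1,\dots,x_n)<s_i \text{ for each } i=1,\dots,l\}$$ consists of at most $p$ intervals (i.e. is a union of at most $p$ intervals, possibly empty).
   Context: $B_{n-1}(0,\eta)$ denotes the open ball of radius $\eta$ centered at the origin in $\mathbb{R}^{n-1}$. It is understood that $\eta$ is small enough that $B_{n-1}(0,\eta)\times(-\eta,\eta)$ lies in the domain of all the $f_i$. *)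

theory Defs
  imports "HOL-Analysis.Analysis"
begin

text \<open>
  Multi-indices are the functions \<open>'n \<Rightarrow> nat\<close>; the power series is summed
  unconditionally, which over the reals means absolutely.
\<close>

definition real_analytic_at :: "(real ^ 'n \<Rightarrow> real) \<Rightarrow> real ^ 'n \<Rightarrow> bool" where
  "real_analytic_at f a \<longleftrightarrow>
     (\<exists>(c :: ('n \<Rightarrow> nat) \<Rightarrow> real) r. r > 0 \<and>
        (\<forall>x \<in> ball a r.
           ((\<lambda>\<alpha>. c \<alpha> * (\<Prod>i\<in>UNIV. (x $ i - a $ i) ^ \<alpha> i)) has_sum f x) UNIV))"

definition real_analytic_on :: "(real ^ 'n \<Rightarrow> real) \<Rightarrow> (real ^ 'n) set \<Rightarrow> bool" where
  "real_analytic_on f S \<longleftrightarrow> (\<forall>a\<in>S. real_analytic_at f a)"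

text \<open>
  The coordinates of \<open>real ^ 'n\<close> are ordered by the linear order on \<open>'n\<close>, and the
  coordinate $x_n$ is the one with the greatest index.  The space of the first $n-1$
  coordinates is identified with the hyperplane $x_n = 0$, with the induced norm.
  Thus $n = 1$ (where that space is a single point) is included, which would not be the
  case for a product type \<open>real ^ 'm \<times> real\<close>.
\<close>

definition last_index :: "'n::{finite,linorder}" where
  "last_index = Max UNIV"

definition base_ball :: "real \<Rightarrow> (real ^ 'n::{finite,linorder}) set" where
  "base_ball r = {y. y $ last_index = 0 \<and> norm y < r}"

definition with_last ::
  "real ^ 'n::{finite,linorder} \<Rightarrow> real \<Rightarrow> real ^ 'n::{finite,linorder}" where
  "with_last y t = (\<chi> i. if i = last_index then t else y $ i)"

text \<open>The intervals may be empty, degenerate, and need not be disjoint.\<close>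

definition union_of_at_most_intervals :: "nat \<Rightarrow> real set \<Rightarrow> bool" where
  "union_of_at_most_intervals p S \<longleftrightarrow>
     (\<exists>\<I>. finite \<I> \<and> card \<I> \<le> p \<and> (\<forall>I\<in>\<I>. is_interval I) \<and> S = \<Union>\<I>)"

end

theory Submission
  imports Defs "HOL-Computational_Algebra.Primes"
begin

text \<open>
  Expand $f(y,t) = \sum_k a_k(y) t^k$.  The heart of the matter is a Bautin-type estimate
  $|a_k(y)| \le K M^k \sum_{j \le d} |a_j(y)|$ for all $k \ge 1$ and all $y$ near 0, with $d$ and the
  constants independent of $y$ (and $j \ge 1$ in the sum).  Given this, some derivative of
  $f(y,\cdot)$ of order between 1 and $d+1$ has no zero near 0 (or $f(y,\cdot)$ is constant), so by
  Rolle $f(y,\cdot) - s$ has at most $d+1$ zeros, whatever $s$ is.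

  The estimate expresses that finitely many $a_j$ dominate the others, and is proved by division
  by a standard basis.  Distinct primes $p_i$ order the exponents by
  $N(\alpha) = \prod_i p_i^{\alpha_i}$, which is injective by unique factorization, and
  $N(\alpha)^{-s}$ is the supremum of $|y^\alpha|$ on the polydisc $|y_i| \le p_i^{-s}$.
  Dickson's lemma gives finitely many germs whose leading exponents generate all leading
  exponents; for large $s$ each of them is a small perturbation of its leading monomial,
  so that division by them is possible with norm bounds.
\<close>

subsection \<open>Sublevel sets of power series in one variable\<close>

text \<open>The obstacle is uniformity in y and s together. All a_k(y) with k >= 1 may tend to 0 as
  y does (f = y t is an example), so a zero count obtained for one slice does not persist with a
  fixed radius; what survives is a comparison of the coefficients with each other. As s is
  arbitrary, the constant term a_0(y) - s cannot enter this comparison, hence the indices from 1 on.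
  The prime weights meet several demands at once. N is multiplicative and injective, so it orders
  monomials totally and compatibly with products. Its initial segments are finite, so division
  becomes a recursion. Its values are integers: N(\<gamma>) > N(\<beta>) means N(\<gamma>) >=
  N(\<beta>) + 1, so the weight of \<gamma> relative to that of \<beta> decays at least like
  (N(\<beta>) / (N(\<beta>) + 1))^s, at a rate independent of \<gamma>; this makes a leading
  monomial beat a whole infinite tail on small polydiscs. The divisors are finitely many and the
  polydisc is fixed before k is chosen, so k enters the final bound only through the norm of a_k,
  which grows geometrically by convergence of the series.\<close>

lemma union_of_at_most_intervals_mono:
  "union_of_at_most_intervals p S \<Longrightarrow> p \<le> q \<Longrightarrow> union_of_at_most_intervals q S"
  unfolding union_of_at_most_intervals_def by (blast intro: order_trans)

lemma union_of_at_most_intervals_UNIV: "union_of_at_most_intervals 1 UNIV"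
  unfolding union_of_at_most_intervals_def
  by (rule exI[of _ "{UNIV}"]) auto

lemma union_of_at_most_intervals_interval:
  "is_interval S \<Longrightarrow> union_of_at_most_intervals 1 S"
  unfolding union_of_at_most_intervals_def
  by (rule exI[of _ "{S}"]) auto

lemma union_of_at_most_intervals_Int:
  assumes "union_of_at_most_intervals p S" "union_of_at_most_intervals q T"
  shows "union_of_at_most_intervals (p * q) (S \<inter> T)"
proof -
  from assms obtain A B where A: "finite A" "card A \<le> p" "\<forall>I\<in>A. is_interval I" "S = \<Union>A"
    and B: "finite B" "card B \<le> q" "\<forall>I\<in>B. is_interval I" "T = \<Union>B"
    unfolding union_of_at_most_intervals_def by auto
  let ?C = "(\<lambda>(I, J). I \<inter> J) ` (A \<times> B)"
  have "card ?C \<le> card (A \<times> B)"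
    using A B by (intro card_image_le) auto
  also have "\<dots> \<le> p * q"
    using A B by (simp add: card_cartesian_product mult_le_mono)
  finally have "card ?C \<le> p * q" .
  moreover have "S \<inter> T = \<Union>?C"
    using A B by auto
  moreover have "\<forall>I\<in>?C. is_interval I"
    using A B by (auto intro!: is_interval_Int)
  ultimately show ?thesis
    unfolding union_of_at_most_intervals_def using A B
    by (intro exI[of _ ?C]) auto
qed

lemma union_of_at_most_intervals_INT:
  assumes "finite A" "\<And>i. i \<in> A \<Longrightarrow> union_of_at_most_intervals (p i) (S i)"
  shows "union_of_at_most_intervals (\<Prod>i\<in>A. p i) (\<Inter>i\<in>A. S i)"
  using assms
proof (induction A rule: finite_induct)
  case empty
  then show ?case using union_of_at_most_intervals_UNIV by simp
next
  case (insert x A)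
  then show ?case
    using union_of_at_most_intervals_Int[of "p x" "S x" "\<Prod>i\<in>A. p i" "\<Inter>i\<in>A. S i"] by simp
qed

text \<open>Each interval collects the points lying above a fixed number of zeros.\<close>

lemma union_of_at_most_intervals_sublevel:
  fixes g :: "real \<Rightarrow> real"
  assumes J: "is_interval J" and cont: "continuous_on J g"
    and Z: "finite {t\<in>J. g t = s}" "card {t\<in>J. g t = s} \<le> m"
  shows "union_of_at_most_intervals (Suc m) {t\<in>J. g t < s}"
proof -
  define Z where "Z = {t\<in>J. g t = s}"
  have fZ: "finite Z" and cZ: "card Z \<le> m" using Z by (auto simp: Z_def)
  define c where "c t = card {z\<in>Z. z < t}" for t
  define I where "I k = {t\<in>J. g t < s \<and> c t = k}" for k
  have "is_interval (I k)" for k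
  proof -
    have conv: "u \<in> I k" if ab: "a \<in> I k" "b \<in> I k" "a \<le> u" "u \<le> b" for a b u
    proof -
      have aJ: "a \<in> J" "b \<in> J" "g a < s" "g b < s" "c a = k" "c b = k"
        using ab by (auto simp: I_def)
      have uJ: "x \<in> J" if "a \<le> x" "x \<le> b" for x
        using J aJ that unfolding is_interval_1 by blast
      \<comment> \<open>Nested finite sets of equal cardinality coincide, so no zero lies in [a, b).
        By the intermediate value theorem \<open>g\<close> then stays below \<open>s\<close> between
        \<open>a\<close> and \<open>b\<close>.\<close>
      have "{z\<in>Z. z < a} = {z\<in>Z. z < b}"
      proof (rule card_subset_eq)
        show "card {z\<in>Z. z < a} = card {z\<in>Z. z < b}" using aJ by (simp add: c_def)
        show "{z\<in>Z. z < a} \<subseteq> {z\<in>Z. z < b}" using ab by auto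
      qed (use fZ in simp)
      then have "z \<in> Z \<and> z < a \<longleftrightarrow> z \<in> Z \<and> z < b" for z
        unfolding set_eq_iff by simp
      then have noZ: "z \<notin> Z" if "a \<le> z" "z < b" for z
        using that by (meson not_le)
      have "g u < s"
      proof (rule ccontr)
        assume "\<not> g u < s"
        then have "\<exists>x\<ge>a. x \<le> u \<and> g x = s"
          using aJ ab uJ by (intro IVT') (auto intro: continuous_on_subset[OF cont])
        then obtain x where x: "a \<le> x" "x \<le> u" "g x = s" by auto
        then have "x \<in> Z" using uJ ab by (auto simp: Z_def)
        moreover have "x \<noteq> b" using x aJ by auto
        ultimately show False using noZ[of x] x ab by auto
      qed
      moreover have "z < u \<longleftrightarrow> z < a" if "z \<in> Z" for z
        using noZ[of z] that ab aJ(5) by (cases "a \<le> z"; cases "z = b") (use aJ in \<open>auto simp: Z_def\<close>)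
      then have "{z\<in>Z. z < u} = {z\<in>Z. z < a}" by blast
      then have "c u = k" using aJ by (simp add: c_def)
      ultimately show ?thesis using uJ ab by (auto simp: I_def)
    qed
    show ?thesis
      unfolding is_interval_1 by (intro ballI allI impI, elim conjE) (rule conv)
  qed
  moreover have "c t \<le> m" for t
    using card_mono[OF fZ, of "{z\<in>Z. z < t}"] cZ by (auto simp: c_def)
  then have "{t\<in>J. g t < s} = \<Union>(I ` {..m})"
    by (auto simp: I_def)
  moreover have "card (I ` {..m}) \<le> Suc m"
    using card_image_le[of "{..m}" I] by simp
  ultimately show ?thesis
    unfolding union_of_at_most_intervals_def
    by (intro exI[of _ "I ` {..m}"]) auto
qed

text \<open>Induction adding the zeros in increasing order: each new largest zero \<open>b\<close>
  contributes a critical point in the gap between \<open>Max A\<close> and \<open>b\<close>. The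
  conjunct \<open>w < Max Z\<close> strengthens the induction, since it shows that this point is not
  yet in \<open>W\<close>.\<close>

lemma Rolle_zeros_finite:
  fixes f f' :: "real \<Rightarrow> real"
  assumes J: "is_interval J" and d: "\<And>t. t \<in> J \<Longrightarrow> (f has_real_derivative f' t) (at t)"
    and Z: "finite Z" "Z \<noteq> {}" "Z \<subseteq> {t\<in>J. f t = 0}"
  shows "\<exists>W. finite W \<and> W \<subseteq> {t\<in>J. f' t = 0} \<and> Suc (card W) = card Z \<and> (\<forall>w\<in>W. w < Max Z)"
  using Z
proof (induction Z rule: finite_linorder_max_induct)
  case empty
  then show ?case by simp
next
  case (insert b A)
  show ?case
  proof (cases "A = {}")
    case True
    then show ?thesis by (intro exI[of _ "{}"]) auto
  next
    case False
    then obtain W where W: "finite W" "W \<subseteq> {t\<in>J. f' t = 0}" "Suc (card W) = card A"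
      "\<forall>w\<in>W. w < Max A"
      using insert.IH insert.prems by blast
    have MA: "Max A \<in> A" using insert.hyps False by auto
    then have lt: "Max A < b" using insert.hyps by auto
    have inJ: "x \<in> J" if "Max A \<le> x" "x \<le> b" for x
      using J insert.prems MA that unfolding is_interval_1 by blast
    have "\<exists>z. Max A < z \<and> z < b \<and> (f has_real_derivative 0) (at z)"
    proof (rule Rolle[OF lt])
      show "f (Max A) = f b" using insert.prems MA by auto
      show "continuous_on {Max A..b} f"
        using inJ by (intro continuous_at_imp_continuous_on ballI DERIV_isCont[OF d]) auto
      show "f differentiable (at x)" if "Max A < x" "x < b" for x
        using inJ[of x] d[of x] that real_differentiable_def by auto
    qed
    then obtain z where z: "Max A < z" "z < b" "(f has_real_derivative 0) (at z)" by auto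
    have "z \<in> J" using inJ[of z] z by simp
    moreover have "f' z = 0" using DERIV_unique[OF d[OF \<open>z \<in> J\<close>] z(3)] .
    moreover have "z \<notin> W" using W(4) z(1) less_asym by blast
    moreover have "Max (insert b A) = b"
      using insert.hyps by (intro Max_eqI) (auto intro: less_imp_le)
    moreover have "b \<notin> A" using insert.hyps by auto
    moreover have "\<forall>w\<in>W. w < b" using W(4) lt less_trans by blast
    ultimately show ?thesis
      using W z insert.hyps by (intro exI[of _ "insert z W"]) simp
  qed
qed

text \<open>Each application of Rolle's theorem loses at most one zero, and after \<open>j\<close>
  differentiations none is left. A whole sequence \<open>D\<close> of derivatives is assumed so that
  the induction can pass to \<open>\<lambda>k. D (Suc k)\<close>.\<close>

lemma card_zeros_le_if_deriv_nonzero: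
  fixes D :: "nat \<Rightarrow> real \<Rightarrow> real"
  assumes J: "is_interval J"
    and d: "\<And>k t. t \<in> J \<Longrightarrow> (D k has_real_derivative D (Suc k) t) (at t)"
    and nz: "\<And>t. t \<in> J \<Longrightarrow> D j t \<noteq> 0"
  shows "finite {t\<in>J. D 0 t = 0} \<and> card {t\<in>J. D 0 t = 0} \<le> j"
proof -
  have bound: "card Z \<le> j" if "finite Z" "Z \<subseteq> {t\<in>J. D 0 t = 0}" for Z
    using d nz that
  proof (induction j arbitrary: D Z)
    case 0
    then have "Z = {}" by auto
    then show ?case by simp
  next
    case (Suc j)
    show ?case
    proof (cases "Z = {}")
      case False
      obtain W where W: "finite W" "W \<subseteq> {t\<in>J. D (Suc 0) t = 0}" "Suc (card W) = card Z"
        using Rolle_zeros_finite[OF J Suc.prems(1)[of _ 0] Suc.prems(3) False Suc.prems(4)] by auto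
      have "card W \<le> j"
        using Suc.IH[of "\<lambda>k. D (Suc k)" W] Suc.prems W by auto
      then show ?thesis using W by simp
    qed simp
  qed
  show ?thesis
  proof (rule ccontr)
    assume *: "\<not> ?thesis"
    \<comment> \<open>In HOL \<open>card\<close> of an infinite set is 0, so finiteness is a
      separate claim. Whichever of the two claims fails, there are \<open>Suc j\<close> zeros
      forming a finite set.\<close>
    obtain Z where "finite Z" "Z \<subseteq> {t\<in>J. D 0 t = 0}" "card Z = Suc j"
    proof (cases "finite {t\<in>J. D 0 t = 0}")
      case True
      then have "Suc j \<le> card {t\<in>J. D 0 t = 0}" using * by auto
      from obtain_subset_with_card_n[OF this] show ?thesis using that by blast
    next
      case False
      from infinite_arbitrarily_large[OF this, of "Suc j"] show ?thesis using that by blast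
    qed
    then show False using bound[of Z] by simp
  qed
qed

section \<open>Uniform bounds for the derivatives of a power series\<close>

lemma diffs_funpow:
  fixes A :: "nat \<Rightarrow> real"
  shows "(diffs ^^ j) A n = fact (n + j) / fact n * A (n + j)"
proof (induction j arbitrary: n)
  case (Suc j)
  have "(diffs ^^ Suc j) A n = of_nat (Suc n) * (diffs ^^ j) A (Suc n)"
    by (simp add: diffs_def)
  also have "\<dots> = fact (n + Suc j) / fact n * A (n + Suc j)"
    by (subst Suc.IH) (simp add: fact_Suc divide_simps del: of_nat_Suc)
  finally show ?case .
qed simp

text \<open>The quotient is a binomial coefficient. The bound trades the factor
  \<open>fact (n + j) / fact n\<close>, produced by \<open>j\<close> differentiations, for a
  geometric one, at the cost of doubling the base.\<close>

lemma fact_add_le: "(fact (n + j) :: real) \<le> 2 ^ (n + j) * fact n * fact j"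
proof -
  have "((n + j) choose j) \<le> 2 ^ (n + j)"
    by (rule binomial_le_pow2)
  then have "real ((n + j) choose j) \<le> 2 ^ (n + j)"
    by (metis of_nat_le_iff of_nat_numeral of_nat_power)
  moreover have "real ((n + j) choose j) * (fact n * fact j) = fact (n + j)"
    by (subst binomial_fact) auto
  ultimately show ?thesis
    using mult_right_mono[of "real ((n + j) choose j)" "2 ^ (n + j)" "fact n * fact j"] by simp
qed

lemma summable_powser_if_geometric_bound:
  fixes A :: "nat \<Rightarrow> real"
  assumes "\<And>n. \<bar>A n\<bar> \<le> L * M ^ n" "M > 0" "\<bar>t\<bar> < 1 / M"
  shows "summable (\<lambda>n. A n * t ^ n)"
proof (rule summable_comparison_test')
  have "\<bar>M * t\<bar> < 1" using assms by (simp add: abs_mult field_simps)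
  then show "summable (\<lambda>n. L * \<bar>M * t\<bar> ^ n)"
    by (intro summable_mult summable_geometric) auto
  show "norm (A n * t ^ n) \<le> L * \<bar>M * t\<bar> ^ n" for n
  proof -
    have "norm (A n * t ^ n) \<le> (L * M ^ n) * \<bar>t\<bar> ^ n"
      using assms by (simp add: abs_mult power_abs mult_right_mono)
    then show ?thesis using assms by (simp add: abs_mult power_mult_distrib)
  qed
qed

text \<open>
  Let \<open>j\<close> be the index of the largest of the coefficients controlling the series.  Near 0,
  the \<open>j\<close>-th derivative is dominated by its constant term, uniformly in the coefficients.
\<close>

lemma sublevel_powser:
  fixes K M :: real and d :: nat
  assumes K: "K > 0" and M: "M > 0"
  shows "\<exists>\<eta>>0. \<eta> < 1 / M \<and> (\<forall>A s J. (\<forall>k. \<bar>A (Suc k)\<bar> \<le> K * M ^ k * (\<Sum>i\<le>d. \<bar>A (Suc i)\<bar>)) \<longrightarrow>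
    is_interval J \<longrightarrow> J \<subseteq> {-\<eta><..<\<eta>} \<longrightarrow>
    union_of_at_most_intervals (d + 2) {t\<in>J. (\<Sum>n. A n * t ^ n) < s})"
proof -
  \<comment> \<open>A base of at least 1 makes its powers increasing, so that one constant
    \<open>Q\<close> serves every possible order \<open>j \<le> Suc d\<close>.\<close>
  define M' where "M' = 1 + M"
  have M': "M' \<ge> 1" "M \<le> M'" "M' > 0" using M by (auto simp: M'_def)
  \<comment> \<open>Relative to its constant term, of size \<open>fact j * m\<close>, the
    \<open>j\<close>-th derivative has \<open>n\<close>-th coefficient at most
    \<open>Q * (2 * M') ^ n\<close> for n >= 1. Then \<open>q\<close> is chosen so that
    \<open>Q\<close> times the geometric tail \<open>q / (1 - q)\<close> is below 1, and
    \<open>\<eta>\<close> so that \<open>2 * M' * \<bar>t\<bar> \<le> q\<close>.\<close>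
  define Q where "Q = K * real (Suc d) * (2 * M') ^ Suc d"
  have Q: "Q > 0" using K M' by (auto simp: Q_def)
  define q where "q = 1 / (2 * (Q + 1))"
  have q: "q > 0" "q < 1/2" using Q by (auto simp: q_def divide_simps)
  have qQ: "Q * (q / (1 - q)) < 1"
  proof -
    have "q * (2 * (Q + 1)) = 1" using Q by (simp add: q_def)
    then have "Q * q < 1 - q" using q by (simp add: algebra_simps)
    then show ?thesis using q by (simp add: divide_less_eq)
  qed
  define \<eta> where "\<eta> = q / (2 * M')"
  have \<eta>: "\<eta> > 0" using q M' by (auto simp: \<eta>_def)
  have "\<eta> * M < 1"
  proof -
    have "\<eta> * M \<le> \<eta> * M'" using \<eta> M' by (intro mult_left_mono) auto
    also have "\<dots> = q / 2" using M' by (simp add: \<eta>_def)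
    finally show ?thesis using q by simp
  qed
  then have \<eta>M: "\<eta> < 1 / M" using M by (simp add: field_simps)
  have "union_of_at_most_intervals (d + 2) {t\<in>J. (\<Sum>n. A n * t ^ n) < s}"
    if A: "\<forall>k. \<bar>A (Suc k)\<bar> \<le> K * M ^ k * (\<Sum>i\<le>d. \<bar>A (Suc i)\<bar>)"
      and J: "is_interval J" "J \<subseteq> {-\<eta><..<\<eta>}" for A J s
  proof -
    define S where "S = (\<Sum>i\<le>d. \<bar>A (Suc i)\<bar>)"
    have A': "\<bar>A (Suc k)\<bar> \<le> K * M ^ k * S" for k using A by (simp add: S_def)
    show ?thesis
    proof (cases "S = 0")
      case True
      then have "A (Suc k) = 0" for k using A'[of k] by simp
      then have "(\<lambda>k. A k * t ^ k) = (\<lambda>k. if k = 0 then A k else 0)" for t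
        by (intro ext) (metis mult.right_neutral mult_zero_left not0_implies_Suc power_0)
      then have "(\<Sum>n. A n * t ^ n) = A 0" for t
        by (simp only: sums_unique[OF sums_single[of 0 A], symmetric])
      then have "{t\<in>J. (\<Sum>n. A n * t ^ n) < s} = (if A 0 < s then J else {})"
        by auto
      then have "union_of_at_most_intervals 1 {t\<in>J. (\<Sum>n. A n * t ^ n) < s}"
        using J by (intro union_of_at_most_intervals_interval) auto
      then show ?thesis by (rule union_of_at_most_intervals_mono) simp
    next
      case False
      define m where "m = Max ((\<lambda>i. \<bar>A (Suc i)\<bar>) ` {..d})"
      have "m \<in> (\<lambda>i. \<bar>A (Suc i)\<bar>) ` {..d}" unfolding m_def by (intro Max_in) auto
      then obtain i where i: "i \<le> d" "m = \<bar>A (Suc i)\<bar>" by auto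
      have "S \<le> (\<Sum>i\<le>d. m)"
        unfolding S_def m_def by (intro sum_mono Max_ge) auto
      then have Sm: "S \<le> real (Suc d) * m" by simp
      \<comment> \<open>Since \<open>j\<close> is at least 1, replacing \<open>A 0\<close> by
        \<open>A 0 - s\<close> does not change the \<open>j\<close>-th derivative; this is where
        independence of \<open>s\<close> comes from.\<close>
      define j where "j = Suc i"
      have j: "j \<le> Suc d" "\<bar>A j\<bar> = m" using i by (auto simp: j_def)
      have S0: "S \<ge> 0" by (auto simp: S_def intro: sum_nonneg)
      have m0: "m > 0"
      proof -
        have "0 < real (Suc d) * m" using S0 False Sm by linarith
        then show ?thesis by (simp add: zero_less_mult_iff)
      qed
      have A2: "\<bar>A (Suc k)\<bar> \<le> K * M' ^ Suc k * (real (Suc d) * m)" for k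
      proof -
        have "M ^ k \<le> M' ^ k" using M M' by (intro power_mono) auto
        also have "\<dots> \<le> M' ^ Suc k" using M' by (intro power_increasing) auto
        finally have "K * M ^ k * S \<le> K * M' ^ Suc k * (real (Suc d) * m)"
          using K M M' S0 Sm by (intro mult_mono) auto
        then show ?thesis using A'[of k] by linarith
      qed
      \<comment> \<open>This bound depends on \<open>A 0\<close>, and below also on
        \<open>s\<close>. It only serves convergence, where the radius alone matters, and the radius
        does not depend on \<open>L\<close>.\<close>
      define L where "L = \<bar>A 0\<bar> + K * (real (Suc d) * m)"
      have AL: "\<bar>A n\<bar> \<le> L * M' ^ n" for n
      proof (cases n)
        case 0
        then show ?thesis using K m0 by (simp add: L_def)
      next
        case (Suc k)
        then have "\<bar>A n\<bar> \<le> K * (real (Suc d) * m) * M' ^ n"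
          using A2[of k] by (simp add: mult_ac)
        also have "\<dots> \<le> L * M' ^ n" using M' by (intro mult_right_mono) (auto simp: L_def)
        finally show ?thesis .
      qed
      \<comment> \<open>\<open>diffs\<close> is formal differentiation of a coefficient sequence, so
        \<open>D k\<close> is the \<open>k\<close>-th derivative of the series minus
        \<open>s\<close>.\<close>
      define B where "B k = (diffs ^^ k) (A(0 := A 0 - s))" for k
      define D where "D k t = (\<Sum>n. B k n * t ^ n)" for k t
      have B: "B k n = fact (n + k) / fact n * (A(0 := A 0 - s)) (n + k)" for k n
        by (simp add: B_def diffs_funpow)
      have AL': "\<bar>(A(0 := A 0 - s)) n\<bar> \<le> (L + \<bar>s\<bar>) * M' ^ n" for n
      proof -
        have "L * M' ^ n \<le> (L + \<bar>s\<bar>) * M' ^ n" using M' by (intro mult_right_mono) auto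
        then show ?thesis using AL[of n] AL[of 0] by auto
      qed
      have Bb: "\<bar>B k n\<bar> \<le> fact k * (2 * M') ^ k * (L + \<bar>s\<bar>) * (2 * M') ^ n" for k n
      proof -
        have "\<bar>B k n\<bar> = fact (n + k) / fact n * \<bar>(A(0 := A 0 - s)) (n + k)\<bar>"
          unfolding B abs_mult by simp
        also have "\<dots> \<le> (2 ^ (n + k) * fact k) * ((L + \<bar>s\<bar>) * M' ^ (n + k))"
        proof (rule mult_mono)
          show "fact (n + k) / fact n \<le> (2 ^ (n + k) * fact k :: real)"
            using fact_add_le[of n k] by (simp add: divide_le_eq mult_ac)
          show "\<bar>(A(0 := A 0 - s)) (n + k)\<bar> \<le> (L + \<bar>s\<bar>) * M' ^ (n + k)" by (rule AL')
        qed auto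
        also have "\<dots> = fact k * (2 * M') ^ k * (L + \<bar>s\<bar>) * (2 * M') ^ n"
          by (simp add: power_add power_mult_distrib)
        finally show ?thesis .
      qed
      have small: "\<bar>t\<bar> < 1 / (2 * M')" if "\<bar>t\<bar> \<le> \<eta>" for t
      proof -
        have "\<eta> < 1 / (2 * M')" unfolding \<eta>_def using q M' by (simp add: divide_strict_right_mono)
        then show ?thesis using that by simp
      qed
      have Bsum: "summable (\<lambda>n. B k n * t ^ n)" if "\<bar>t\<bar> \<le> \<eta>" for k t
        using summable_powser_if_geometric_bound[OF Bb _ small[OF that], of k] M' by simp
      have deriv: "(D k has_real_derivative D (Suc k) t) (at t)" if "\<bar>t\<bar> < \<eta>" for k t
      proof -
        have "D (Suc k) t = (\<Sum>n. diffs (B k) n * t ^ n)" by (simp add: D_def B_def)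
        then show ?thesis
          using termdiffs_strong[of "B k" \<eta> t] Bsum[of \<eta> k] \<eta> that by (simp add: D_def[abs_def])
      qed
      have nz: "D j t \<noteq> 0" if t: "\<bar>t\<bar> < \<eta>" for t
      proof
        assume "D j t = 0"
        then have "(\<lambda>n. B j n * t ^ n) sums 0"
          using Bsum[of t j] t by (simp add: D_def sums_iff)
        \<comment> \<open>At a zero the constant term would have to cancel against the rest of the
          series, but the rest turns out strictly smaller than \<open>fact j * m\<close>.\<close>
        then have s1: "(\<lambda>n. B j (Suc n) * t ^ Suc n) sums (- B j 0)"
          by (subst sums_Suc_iff) simp
        define E where "E = fact j * m * Q"
        have Bj: "\<bar>B j (Suc n)\<bar> \<le> E * (2 * M') ^ Suc n" for n
        proof -
          obtain k where k: "Suc n + j = Suc k" by simp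
          have "\<bar>B j (Suc n)\<bar> = fact (Suc n + j) / fact (Suc n) * \<bar>A (Suc n + j)\<bar>"
            unfolding B abs_mult by simp
          also have "\<dots> \<le> (2 ^ (Suc n + j) * fact j) * (K * M' ^ (Suc n + j) * (real (Suc d) * m))"
          proof (rule mult_mono)
            show "fact (Suc n + j) / fact (Suc n) \<le> (2 ^ (Suc n + j) * fact j :: real)"
              using fact_add_le[of "Suc n" j] by (simp add: divide_le_eq mult_ac del: fact_Suc)
            show "\<bar>A (Suc n + j)\<bar> \<le> K * M' ^ (Suc n + j) * (real (Suc d) * m)"
              using A2[of k] unfolding k .
          qed auto
          also have "\<dots> = fact j * m * (K * real (Suc d) * (2 * M') ^ j) * (2 * M') ^ Suc n"
            by (simp add: power_add power_mult_distrib)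
          also have "\<dots> \<le> E * (2 * M') ^ Suc n"
            unfolding E_def Q_def using j M' K m0
            by (intro mult_right_mono mult_left_mono power_increasing) auto
          finally show ?thesis .
        qed
        define x where "x = 2 * M' * \<bar>t\<bar>"
        have x: "0 \<le> x" "x \<le> q" using t M' by (auto simp: x_def \<eta>_def field_simps)
        have bnd: "norm (B j (Suc n) * t ^ Suc n) \<le> E * x ^ Suc n" for n
        proof -
          have "norm (B j (Suc n) * t ^ Suc n) = \<bar>B j (Suc n)\<bar> * \<bar>t\<bar> ^ Suc n"
            by (simp only: real_norm_def abs_mult power_abs)
          also have "\<dots> \<le> (E * (2 * M') ^ Suc n) * \<bar>t\<bar> ^ Suc n"
            by (intro mult_right_mono Bj) auto
          also have "\<dots> = E * x ^ Suc n" by (simp only: x_def power_mult_distrib mult.assoc)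
          finally show ?thesis .
        qed
        have E0: "E \<ge> 0" using m0 Q by (simp add: E_def)
        have "(\<lambda>n. E * x * x ^ n) sums (E * x * (1 / (1 - x)))"
          using x q by (intro sums_mult geometric_sums) auto
        then have s2: "(\<lambda>n. E * x ^ Suc n) sums (E * (x / (1 - x)))"
          by (simp add: mult_ac)
        have "norm (\<Sum>n. B j (Suc n) * t ^ Suc n) \<le> (\<Sum>n. E * x ^ Suc n)"
          by (rule norm_suminf_le[OF bnd sums_summable[OF s2]])
        then have "\<bar>B j 0\<bar> \<le> E * (x / (1 - x))"
          unfolding sums_unique[OF s1, symmetric] sums_unique[OF s2, symmetric] by simp
        also have "\<dots> \<le> E * (q / (1 - q))"
          using x q E0 by (intro mult_left_mono frac_le) auto
        also have "\<dots> = fact j * m * (Q * (q / (1 - q)))" by (simp add: E_def)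
        also have "\<dots> < fact j * m * 1"
          using m0 qQ by (intro mult_strict_left_mono) auto
        finally have "\<bar>B j 0\<bar> < fact j * m" by simp
        moreover have "\<bar>B j 0\<bar> = fact j * m"
          using j(2) by (simp add: B j_def abs_mult)
        ultimately show False by simp
      qed
      have inJ: "\<bar>t\<bar> < \<eta>" if "t \<in> J" for t
      proof -
        have "t \<in> {-\<eta><..<\<eta>}" using J that by blast
        then show ?thesis by auto
      qed
      have D0: "D 0 t = (\<Sum>n. A n * t ^ n) - s" if "\<bar>t\<bar> < \<eta>" for t
      proof -
        have "summable (\<lambda>n. A n * t ^ n)"
        proof (rule summable_powser_if_geometric_bound[OF AL])
          have "1 / (2 * M') \<le> 1 / M'" using M' by (simp add: field_simps)
          then show "\<bar>t\<bar> < 1 / M'" using small[of t] that by simp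
        qed (use M' in auto)
        then have "(\<lambda>n. A n * t ^ n - (if n = 0 then s else 0)) sums ((\<Sum>n. A n * t ^ n) - s)"
          by (intro sums_diff summable_sums sums_single[of 0 "\<lambda>_. s"])
        moreover have "A n * t ^ n - (if n = 0 then s else 0) = B 0 n * t ^ n" for n
          by (auto simp: B_def)
        ultimately have "(\<lambda>n. B 0 n * t ^ n) sums ((\<Sum>n. A n * t ^ n) - s)" by simp
        then show ?thesis unfolding D_def by (rule sums_unique[symmetric])
      qed
      have Dz: "{t\<in>J. D 0 t = 0} = {t\<in>J. (\<Sum>n. A n * t ^ n) = s}"
        using D0 inJ by auto
      have "finite {t\<in>J. D 0 t = 0} \<and> card {t\<in>J. D 0 t = 0} \<le> j"
        by (rule card_zeros_le_if_deriv_nonzero[OF J(1)]) (use deriv nz inJ in auto)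
      then have fc: "finite {t\<in>J. (\<Sum>n. A n * t ^ n) = s}" "card {t\<in>J. (\<Sum>n. A n * t ^ n) = s} \<le> j"
        unfolding Dz by auto
      have "continuous_on J (\<lambda>t. D 0 t + s)"
        using inJ by (intro continuous_intros continuous_at_imp_continuous_on ballI
            DERIV_isCont[OF deriv]) auto
      then have "continuous_on J (\<lambda>t. \<Sum>n. A n * t ^ n)"
        by (rule continuous_on_eq) (use D0 inJ in auto)
      \<comment> \<open>At most \<open>j \<le> Suc d\<close> zeros leave at most
        \<open>Suc j \<le> d + 2\<close> intervals.\<close>
      from union_of_at_most_intervals_sublevel[OF J(1) this fc] show ?thesis
        by (rule union_of_at_most_intervals_mono) (use j in auto)
    qed
  qed
  then show ?thesis using \<eta> \<eta>M by blast
qed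

subsection \<open>Dickson's lemma and triangular systems\<close>

text \<open>Some subsequence is monotone. A decreasing sequence of naturals is constant once it
  attains its minimum, so a tail of it is increasing as well.\<close>

lemma nat_seq_incseq_subseq:
  fixes X :: "nat \<Rightarrow> nat"
  shows "\<exists>r. strict_mono r \<and> incseq (X \<circ> r)"
proof -
  obtain q where q: "strict_mono q" "monoseq (\<lambda>n. X (q n))"
    using seq_monosub[of X] by blast
  consider "incseq (\<lambda>n. X (q n))" | "decseq (\<lambda>n. X (q n))"
    using q(2) by (auto simp: monoseq_iff)
  then show ?thesis
  proof cases
    case 1
    then show ?thesis using q by (auto simp: o_def)
  next
    case 2
    define m where "m = (LEAST v. v \<in> range (\<lambda>n. X (q n)))"
    have "m \<in> range (\<lambda>n. X (q n))" unfolding m_def by (rule LeastI_ex) auto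
    then obtain n0 where n0: "m = X (q n0)" by auto
    have "X (q (k + n0)) = m" for k
    proof (rule antisym)
      show "X (q (k + n0)) \<le> m" unfolding n0 using 2 by (rule decseqD) simp
      show "m \<le> X (q (k + n0))" unfolding m_def by (rule Least_le) auto
    qed
    then have "incseq (X \<circ> (\<lambda>k. q (k + n0)))" by (simp add: incseq_def)
    moreover have "strict_mono (\<lambda>k. q (k + n0))"
      using q(1) by (simp add: strict_mono_def)
    ultimately show ?thesis by blast
  qed
qed

lemma fun_seq_incseq_subseq:
  fixes f :: "nat \<Rightarrow> 'i \<Rightarrow> nat"
  assumes "finite A"
  shows "\<exists>r. strict_mono r \<and> (\<forall>i\<in>A. incseq (\<lambda>k. f (r k) i))"
  using assms
proof (induction A rule: finite_induct)
  case empty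
  show ?case by (intro exI[of _ id]) (auto simp: strict_mono_def)
next
  case (insert x A)
  then obtain r where r: "strict_mono r" "\<forall>i\<in>A. incseq (\<lambda>k. f (r k) i)" by blast
  obtain q where q: "strict_mono q" "incseq ((\<lambda>k. f (r k) x) \<circ> q)"
    using nat_seq_incseq_subseq by blast
  have "strict_mono (r \<circ> q)" using r q by (simp add: strict_mono_def)
  moreover have "incseq (\<lambda>k. f ((r \<circ> q) k) i)" if "i \<in> insert x A" for i
  proof (cases "i = x")
    case False
    then have "incseq (\<lambda>k. f (r k) i)" using r that by auto
    then show ?thesis
      using strict_mono_mono[OF q(1)] unfolding incseq_def monotone_def by simp
  qed (use q in \<open>simp add: o_def\<close>)
  ultimately show ?case by blast
qed

text \<open>\<open>B\<close> consists of the minimal elements of \<open>S\<close>. If there were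
  infinitely many, a subsequence increasing in every coordinate would contain two distinct
  comparable ones. Descent on the sum of the coordinates finds a minimal element below any given
  one.\<close>

lemma Dickson:
  fixes S :: "('n::finite \<Rightarrow> nat) set"
  shows "\<exists>B. finite B \<and> B \<subseteq> S \<and> (\<forall>\<alpha>\<in>S. \<exists>\<beta>\<in>B. \<beta> \<le> \<alpha>)"
proof -
  define B where "B = {\<beta>\<in>S. \<forall>\<gamma>\<in>S. \<gamma> \<le> \<beta> \<longrightarrow> \<gamma> = \<beta>}"
  have "finite B"
  proof (rule ccontr)
    assume "infinite B"
    then obtain f :: "nat \<Rightarrow> 'n \<Rightarrow> nat" where f: "inj f" "range f \<subseteq> B"
      using infinite_countable_subset by blast
    obtain r where r: "strict_mono r" "\<forall>i\<in>UNIV. incseq (\<lambda>k. f (r k) i)"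
      using fun_seq_incseq_subseq[of UNIV f] by auto
    have "f (r 0) i \<le> f (r 1) i" for i
      using r(2) incseqD[of "\<lambda>k. f (r k) i" 0 1] by simp
    then have le: "f (r 0) \<le> f (r 1)" by (simp add: le_fun_def)
    have "f (r 0) \<in> B" "f (r 1) \<in> B" using f by auto
    with le have "f (r 0) = f (r 1)" unfolding B_def by blast
    then have "r 0 = r 1" using f(1) by (simp add: inj_eq)
    moreover have "r 0 < r 1" using r(1) by (simp add: strict_mono_def)
    ultimately show False by simp
  qed
  moreover have "\<exists>\<beta>\<in>B. \<beta> \<le> \<alpha>" if "\<alpha> \<in> S" for \<alpha>
    using that
  proof (induction "\<Sum>i\<in>UNIV. \<alpha> i" arbitrary: \<alpha> rule: less_induct)
    case less
    show ?case
    proof (cases "\<alpha> \<in> B")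
      case False
      then obtain \<gamma> where g: "\<gamma> \<in> S" "\<gamma> \<le> \<alpha>" "\<gamma> \<noteq> \<alpha>" using less.prems by (auto simp: B_def)
      then obtain i where "\<gamma> i \<noteq> \<alpha> i" by blast
      then have i: "\<gamma> i < \<alpha> i" using g(2) by (simp add: le_fun_def order_less_le)
      have "(\<Sum>i\<in>UNIV. \<gamma> i) < (\<Sum>i\<in>UNIV. \<alpha> i)"
        using i g(2) by (intro sum_strict_mono_ex1) (auto simp: le_fun_def)
      from less.hyps[OF this g(1)] obtain \<beta> where "\<beta> \<in> B" "\<beta> \<le> \<gamma>" by blast
      then show ?thesis using g(2) order_trans by blast
    qed auto
  qed
  ultimately show ?thesis by (intro exI[of _ B]) (auto simp: B_def)
qed

text \<open>
  The system is triangular, so a solution is found by recursion along \<open>N\<close>, and its weighted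
  norm is controlled because the perturbation \<open>G\<close> has operator norm at most one half.
\<close>

lemma triangular_solution:
  fixes N :: "'a \<Rightarrow> nat" and G :: "'a \<Rightarrow> 'a \<Rightarrow> real" and w a :: "'a \<Rightarrow> real"
  assumes fin: "\<And>n. finite {x. N x < n}"
    and w: "\<And>x. w x \<ge> 0"
    and contr: "\<And>x F. finite F \<Longrightarrow> (\<Sum>y\<in>F. \<bar>G x y\<bar> * w y) \<le> w x / 2"
    and a: "\<And>F. finite F \<Longrightarrow> (\<Sum>y\<in>F. \<bar>a y\<bar> * w y) \<le> A"
  obtains b where "\<And>y. y \<notin> U \<Longrightarrow> b y = 0"
    and "\<And>y. y \<in> U \<Longrightarrow> b y + (\<Sum>x | N x < N y. b x * G x y) = a y"
    and "\<And>F. finite F \<Longrightarrow> (\<Sum>y\<in>F. \<bar>b y\<bar> * w y) \<le> 2 * A"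
proof -
  define b where "b = wfrec (Wellfounded.measure N)
    (\<lambda>b y. if y \<in> U then a y - (\<Sum>x | N x < N y. b x * G x y) else 0)"
  have b: "b y = (if y \<in> U then a y - (\<Sum>x | N x < N y. b x * G x y) else 0)" for y
  proof -
    have "b y = (if y \<in> U then a y - (\<Sum>x | N x < N y. cut b (Wellfounded.measure N) y x * G x y) else 0)"
      by (rule def_wfrec[OF b_def[THEN eq_reflection] wf_measure])
    also have "(\<Sum>x | N x < N y. cut b (Wellfounded.measure N) y x * G x y) = (\<Sum>x | N x < N y. b x * G x y)"
      by (intro sum.cong) (auto simp: cut_def)
    finally show ?thesis .
  qed
  \<comment> \<open>Summability of \<open>b\<close> is not yet known. On an initial segment of
    \<open>N\<close> the weighted norm X of \<open>b\<close> is a finite sum, so X \<le> A + X / 2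
    can be solved for X.\<close>
  have S: "(\<Sum>y | N y < n. \<bar>b y\<bar> * w y) \<le> 2 * A" for n
  proof -
    let ?F = "{y. N y < n}"
    have "\<bar>b y\<bar> * w y \<le> \<bar>a y\<bar> * w y + (\<Sum>x\<in>?F. \<bar>b x\<bar> * (\<bar>G x y\<bar> * w y))" if "y \<in> ?F" for y
    proof -
      have "\<bar>b y\<bar> \<le> \<bar>a y\<bar> + \<bar>\<Sum>x | N x < N y. b x * G x y\<bar>"
        unfolding b[of y] by auto
      also have "\<bar>\<Sum>x | N x < N y. b x * G x y\<bar> \<le> (\<Sum>x | N x < N y. \<bar>b x\<bar> * \<bar>G x y\<bar>)"
        using sum_abs[of "\<lambda>x. b x * G x y"] by (simp add: abs_mult)
      also have "\<dots> \<le> (\<Sum>x\<in>?F. \<bar>b x\<bar> * \<bar>G x y\<bar>)"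
        using that fin by (intro sum_mono2) auto
      finally have "\<bar>b y\<bar> * w y \<le> (\<bar>a y\<bar> + (\<Sum>x\<in>?F. \<bar>b x\<bar> * \<bar>G x y\<bar>)) * w y"
        using w by (intro mult_right_mono) auto
      then show ?thesis by (simp add: distrib_right sum_distrib_right mult.assoc)
    qed
    then have "(\<Sum>y\<in>?F. \<bar>b y\<bar> * w y) \<le>
        (\<Sum>y\<in>?F. \<bar>a y\<bar> * w y + (\<Sum>x\<in>?F. \<bar>b x\<bar> * (\<bar>G x y\<bar> * w y)))"
      by (rule sum_mono)
    also have "\<dots> = (\<Sum>y\<in>?F. \<bar>a y\<bar> * w y) + (\<Sum>x\<in>?F. \<bar>b x\<bar> * (\<Sum>y\<in>?F. \<bar>G x y\<bar> * w y))"
      unfolding sum.distrib sum_distrib_left by (subst sum.swap[of _ ?F ?F]) (rule refl)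
    also have "\<dots> \<le> A + (\<Sum>x\<in>?F. \<bar>b x\<bar> * (w x / 2))"
      using a[OF fin] contr[OF fin] by (intro add_mono sum_mono mult_left_mono) auto
    also have "(\<Sum>x\<in>?F. \<bar>b x\<bar> * (w x / 2)) = (\<Sum>x\<in>?F. \<bar>b x\<bar> * w x) / 2"
      by (simp add: sum_divide_distrib)
    finally show ?thesis by simp
  qed
  show ?thesis
  proof
    show "b y = 0" if "y \<notin> U" for y using b[of y] that by simp
    show "b y + (\<Sum>x | N x < N y. b x * G x y) = a y" if "y \<in> U" for y using b[of y] that by simp
    show "(\<Sum>y\<in>F. \<bar>b y\<bar> * w y) \<le> 2 * A" if "finite F" for F
    proof -
      have "F \<subseteq> {y. N y < Suc (Max (N ` F))}" using that by (auto simp: less_Suc_eq_le)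
      then have "(\<Sum>y\<in>F. \<bar>b y\<bar> * w y) \<le> (\<Sum>y | N y < Suc (Max (N ` F)). \<bar>b y\<bar> * w y)"
        using w fin by (intro sum_mono2) auto
      then show ?thesis using S by (rule order_trans)
    qed
  qed
qed

subsection \<open>Division by a standard basis\<close>

lemma has_sum_diff:
  fixes f g :: "'a \<Rightarrow> real"
  assumes "(f has_sum a) A" "(g has_sum b) A"
  shows "((\<lambda>x. f x - g x) has_sum (a - b)) A"
  using has_sum_add[OF assms(1), of "\<lambda>x. - g x" "- b"] assms(2) by (simp add: has_sum_uminus)

section \<open>Families of coefficients under weighted l1 norms\<close>

locale prime_weights =
  fixes p :: "'n::finite \<Rightarrow> nat"
  assumes prime_p: "prime (p i)" and inj_p: "inj p"
begin

definition N :: "('n \<Rightarrow> nat) \<Rightarrow> nat" where "N \<alpha> = (\<Prod>i\<in>UNIV. p i ^ \<alpha> i)"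

definition wt :: "nat \<Rightarrow> ('n \<Rightarrow> nat) \<Rightarrow> real" where "wt s \<alpha> = 1 / real (N \<alpha>) ^ s"

definition pw :: "real ^ 'n \<Rightarrow> ('n \<Rightarrow> nat) \<Rightarrow> real" where "pw y \<alpha> = (\<Prod>i\<in>UNIV. (y $ i) ^ \<alpha> i)"

text \<open>Larger \<open>s\<close> means smaller radii, which tend to 0 because primes are at least
  2. One natural number thus indexes a neighbourhood basis of 0, and "near 0" becomes "eventually in
  \<open>s\<close>".\<close>

definition polydisc :: "nat \<Rightarrow> (real ^ 'n) set" where "polydisc s = {y. \<forall>i. \<bar>y $ i\<bar> \<le> 1 / real (p i) ^ s}"

definition sm :: "nat \<Rightarrow> (('n \<Rightarrow> nat) \<Rightarrow> real) \<Rightarrow> bool" where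
  "sm s c \<longleftrightarrow> (\<lambda>\<alpha>. \<bar>c \<alpha>\<bar> * wt s \<alpha>) summable_on UNIV"

text \<open>The weighted l1 norm of the coefficients. As \<open>infsum\<close> is 0 for families
  that are not summable, the value is meaningful only together with \<open>sm s c\<close>.\<close>

definition nrm :: "nat \<Rightarrow> (('n \<Rightarrow> nat) \<Rightarrow> real) \<Rightarrow> real" where
  "nrm s c = (\<Sum>\<^sub>\<infinity>\<alpha>. \<bar>c \<alpha>\<bar> * wt s \<alpha>)"

definition ev :: "(('n \<Rightarrow> nat) \<Rightarrow> real) \<Rightarrow> real ^ 'n \<Rightarrow> real" where
  "ev c y = (\<Sum>\<^sub>\<infinity>\<alpha>. c \<alpha> * pw y \<alpha>)"

text \<open>The coefficients of the product of the series \<open>g\<close> with the monomial of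
  exponent \<open>\<delta>\<close>. The guard prevents truncated subtraction from producing spurious
  terms.\<close>

definition shift :: "('n \<Rightarrow> nat) \<Rightarrow> (('n \<Rightarrow> nat) \<Rightarrow> real) \<Rightarrow> ('n \<Rightarrow> nat) \<Rightarrow> real" where
  "shift \<delta> g \<gamma> = (if \<delta> \<le> \<gamma> then g (\<lambda>i. \<gamma> i - \<delta> i) else 0)"

lemma N_pos: "N \<alpha> > 0"
  unfolding N_def using prime_p by (intro prod_pos) (simp add: prime_gt_0_nat)

lemma N_inj: "N \<alpha> = N \<beta> \<Longrightarrow> \<alpha> = \<beta>"
proof (rule ext)
  fix i assume eq: "N \<alpha> = N \<beta>"
  have "multiplicity (p i) (N \<alpha>) = \<alpha> i" for \<alpha>
  proof -
    have "N \<alpha> = (\<Prod>q\<in>range p. q ^ \<alpha> (inv p q))"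
      unfolding N_def by (subst prod.reindex) (simp_all add: inj_p)
    then show ?thesis
      using multiplicity_prod_prime_powers[of "range p" "p i" "\<lambda>q. \<alpha> (inv p q)"] prime_p inj_p
      by auto
  qed
  then show "\<alpha> i = \<beta> i" using eq by metis
qed

lemma N_add: "N (\<lambda>i. \<alpha> i + \<beta> i) = N \<alpha> * N \<beta>"
  by (simp add: N_def power_add prod.distrib)

lemma finite_N_less: "finite {\<alpha>. N \<alpha> < n}"
proof (rule finite_imageD)
  show "finite (N ` {\<alpha>. N \<alpha> < n})" by (rule finite_subset[of _ "{..<n}"]) auto
  show "inj_on N {\<alpha>. N \<alpha> < n}" by (auto simp: inj_on_def N_inj)
qed

lemma wt_pos: "wt s \<alpha> > 0"
  using N_pos by (simp add: wt_def)

lemma wt_nonneg [simp]: "wt s \<alpha> \<ge> 0"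
  using wt_pos less_imp_le by blast

lemma wt_add: "wt s (\<lambda>i. \<alpha> i + \<beta> i) = wt s \<alpha> * wt s \<beta>"
  by (simp add: wt_def N_add power_mult_distrib)

lemma pw_add: "pw y (\<lambda>i. \<alpha> i + \<beta> i) = pw y \<alpha> * pw y \<beta>"
  by (simp add: pw_def power_add prod.distrib)

lemma wt_antimono: "s \<le> t \<Longrightarrow> wt t \<alpha> \<le> wt s \<alpha>"
  unfolding wt_def using N_pos[of \<alpha>] by (intro divide_left_mono power_increasing) auto

lemma wt_eq_prod: "wt s \<alpha> = (\<Prod>i\<in>UNIV. (1 / real (p i) ^ s) ^ \<alpha> i)"
  by (simp add: wt_def N_def prod_dividef power_divide prod_power_distrib flip: power_mult)
    (simp add: mult.commute)

lemma abs_pw_le: "y \<in> polydisc s \<Longrightarrow> \<bar>pw y \<alpha>\<bar> \<le> wt s \<alpha>"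
proof -
  assume y: "y \<in> polydisc s"
  have "\<bar>pw y \<alpha>\<bar> = (\<Prod>i\<in>UNIV. \<bar>y $ i\<bar> ^ \<alpha> i)" by (simp add: pw_def abs_prod power_abs)
  also have "\<dots> \<le> (\<Prod>i\<in>UNIV. (1 / real (p i) ^ s) ^ \<alpha> i)"
    using y by (intro prod_mono) (auto simp: polydisc_def intro!: power_mono)
  also have "\<dots> = wt s \<alpha>"
    by (simp add: wt_eq_prod)
  finally show ?thesis .
qed

lemma polydisc_antimono: "s \<le> t \<Longrightarrow> polydisc t \<subseteq> polydisc s"
proof
  fix y assume "s \<le> t" and y: "y \<in> polydisc t"
  have "1 / real (p i) ^ t \<le> 1 / real (p i) ^ s" for i
    using \<open>s \<le> t\<close> prime_gt_0_nat[OF prime_p[of i]]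
    by (intro divide_left_mono power_increasing) auto
  then show "y \<in> polydisc s" using y order_trans unfolding polydisc_def by blast
qed

lemma nrm_nonneg: "nrm s c \<ge> 0"
  unfolding nrm_def by (intro infsum_nonneg) auto

lemma sm_antimono: "sm s c \<Longrightarrow> s \<le> t \<Longrightarrow> sm t c"
  unfolding sm_def
  by (rule summable_on_comparison_test) (auto intro: mult_left_mono wt_antimono)

lemma nrm_antimono: "sm s c \<Longrightarrow> s \<le> t \<Longrightarrow> nrm t c \<le> nrm s c"
  unfolding nrm_def using sm_antimono[of s c t]
  by (intro infsum_mono) (auto simp: sm_def intro: mult_left_mono wt_antimono)

lemma sm_cmult: "sm s c \<Longrightarrow> sm s (\<lambda>\<alpha>. k * c \<alpha>)"
  unfolding sm_def abs_mult mult.assoc by (rule summable_on_cmult_right)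

lemma sm_mono: "sm s c \<Longrightarrow> (\<And>\<alpha>. \<bar>d \<alpha>\<bar> \<le> \<bar>c \<alpha>\<bar>) \<Longrightarrow> sm s d"
  unfolding sm_def by (rule summable_on_comparison_test) (auto intro: mult_right_mono)

lemma ev_summable: "sm s c \<Longrightarrow> y \<in> polydisc s \<Longrightarrow> (\<lambda>\<alpha>. c \<alpha> * pw y \<alpha>) summable_on UNIV"
proof -
  assume "sm s c" "y \<in> polydisc s"
  then have "(\<lambda>\<alpha>. norm (c \<alpha> * pw y \<alpha>)) summable_on UNIV"
    unfolding sm_def
    by (intro Infinite_Sum.abs_summable_on_comparison_test'[of "\<lambda>\<alpha>. \<bar>c \<alpha>\<bar> * wt s \<alpha>"])
      (auto simp: abs_mult intro: mult_left_mono abs_pw_le)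
  then show ?thesis by (rule abs_summable_summable)
qed

lemma ev_cmult: "ev (\<lambda>\<alpha>. k * c \<alpha>) y = k * ev c y"
  unfolding ev_def mult.assoc by (rule infsum_cmult_right')

text \<open>Reindexing along the translation by \<open>\<delta>\<close>, whose range supports the
  shifted family. The multiplicative \<open>\<phi>\<close> is left general to cover both the norm of
  a shifted series (\<open>wt s\<close>) and its value at a point (\<open>pw y\<close>).\<close>

lemma has_sum_shift:
  fixes \<phi> :: "('n \<Rightarrow> nat) \<Rightarrow> real"
  assumes \<phi>: "\<And>\<beta>. \<phi> (\<lambda>i. \<delta> i + \<beta> i) = \<phi> \<delta> * \<phi> \<beta>"
    and g: "((\<lambda>\<gamma>. g \<gamma> * \<phi> \<gamma>) has_sum S) UNIV"
  shows "((\<lambda>\<gamma>. shift \<delta> g \<gamma> * \<phi> \<gamma>) has_sum (\<phi> \<delta> * S)) UNIV"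
proof -
  let ?h = "\<lambda>\<beta> i. \<delta> i + \<beta> i"
  have inj: "inj ?h" by (auto simp: inj_def fun_eq_iff)
  have "((\<lambda>\<beta>. \<phi> \<delta> * (g \<beta> * \<phi> \<beta>)) has_sum (\<phi> \<delta> * S)) UNIV"
    using g by (rule has_sum_cmult_right)
  also have "(\<lambda>\<beta>. \<phi> \<delta> * (g \<beta> * \<phi> \<beta>)) = (\<lambda>\<gamma>. shift \<delta> g \<gamma> * \<phi> \<gamma>) \<circ> ?h"
    by (auto simp: fun_eq_iff shift_def \<phi> le_fun_def)
  finally have "((\<lambda>\<gamma>. shift \<delta> g \<gamma> * \<phi> \<gamma>) has_sum (\<phi> \<delta> * S)) (range ?h)"
    by (subst has_sum_reindex[OF inj])
  moreover have "shift \<delta> g \<gamma> = 0" if "\<gamma> \<notin> range ?h" for \<gamma>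
  proof (rule ccontr)
    assume "shift \<delta> g \<gamma> \<noteq> 0"
    then have "\<delta> \<le> \<gamma>" by (auto simp: shift_def split: if_splits)
    then have "\<gamma> = ?h (\<lambda>i. \<gamma> i - \<delta> i)" by (auto simp: fun_eq_iff le_fun_def)
    then have "\<gamma> \<in> range ?h" by (rule range_eqI[of _ _ "\<lambda>i. \<gamma> i - \<delta> i"])
    then show False using that by simp
  qed
  then have "((\<lambda>\<gamma>. shift \<delta> g \<gamma> * \<phi> \<gamma>) has_sum x) (range ?h) \<longleftrightarrow>
      ((\<lambda>\<gamma>. shift \<delta> g \<gamma> * \<phi> \<gamma>) has_sum x) UNIV" for x
    by (intro has_sum_cong_neutral) auto
  ultimately show ?thesis by simp
qed


text \<open>For each exponent \<alpha> above some element of \<open>B\<close>, the shift of a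
  divisor by \<open>\<delta> \<alpha>\<close> has leading monomial \<alpha> and a tail of norm at
  most \<open>wt s \<alpha> / 2\<close>. Forming combinations of these shifts is the identity plus
  an operator of norm at most 1/2 that is triangular for \<open>N\<close>, so there are coefficients
  \<open>b\<close>, of norm at most twice that of \<open>a\<close>, whose combination agrees with
  \<open>a\<close> at all these exponents; \<open>r\<close> is what remains elsewhere. The quotients
  are not exposed, only their effect on values; the denominators come from \<open>wt s (\<delta>
  \<alpha>) = wt s \<alpha> / wt s (\<pi> \<alpha>)\<close>.\<close>

lemma division:
  fixes B :: "('n \<Rightarrow> nat) set" and h :: "('n \<Rightarrow> nat) \<Rightarrow> ('n \<Rightarrow> nat) \<Rightarrow> real"
  assumes B: "finite B"
    and h1: "\<And>\<beta>. \<beta> \<in> B \<Longrightarrow> h \<beta> \<beta> = 1"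
    and hlead: "\<And>\<beta> \<gamma>. \<beta> \<in> B \<Longrightarrow> h \<beta> \<gamma> \<noteq> 0 \<Longrightarrow> \<gamma> \<noteq> \<beta> \<Longrightarrow> N \<beta> < N \<gamma>"
    and hsm: "\<And>\<beta>. \<beta> \<in> B \<Longrightarrow> sm s (h \<beta>)"
    and htail: "\<And>\<beta>. \<beta> \<in> B \<Longrightarrow> nrm s ((h \<beta>)(\<beta> := 0)) \<le> wt s \<beta> / 2"
    and asm: "sm s a"
  obtains r where "sm s r" "\<And>\<gamma>. \<exists>\<beta>\<in>B. \<beta> \<le> \<gamma> \<Longrightarrow> r \<gamma> = 0"
    "\<And>y. y \<in> polydisc s \<Longrightarrow>
      \<bar>ev a y - ev r y\<bar> \<le> 2 * nrm s a * (\<Sum>\<beta>\<in>B. \<bar>ev (h \<beta>) y\<bar> / wt s \<beta>)"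
proof -
  define U where "U = {\<alpha>. \<exists>\<beta>\<in>B. \<beta> \<le> \<alpha>}"
  define \<pi> where "\<pi> \<alpha> = (SOME \<beta>. \<beta> \<in> B \<and> \<beta> \<le> \<alpha>)" for \<alpha>
  have \<pi>: "\<pi> \<alpha> \<in> B" "\<pi> \<alpha> \<le> \<alpha>" if "\<alpha> \<in> U" for \<alpha>
    using someI_ex[of "\<lambda>\<beta>. \<beta> \<in> B \<and> \<beta> \<le> \<alpha>"] that by (auto simp: U_def \<pi>_def)
  define \<delta> where "\<delta> \<alpha> = (\<lambda>i. \<alpha> i - \<pi> \<alpha> i)" for \<alpha>
  have \<delta>: "\<alpha> = (\<lambda>i. \<delta> \<alpha> i + \<pi> \<alpha> i)" if "\<alpha> \<in> U" for \<alpha>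
    using \<pi>(2)[OF that] by (auto simp: \<delta>_def le_fun_def fun_eq_iff)
  define g where "g \<beta> = (h \<beta>)(\<beta> := 0)" for \<beta>
  \<comment> \<open>The shifted divisor without its leading monomial \<alpha>, that is, the
    perturbation fed to \<open>triangular_solution\<close>.\<close>
  define G where "G \<alpha> = (if \<alpha> \<in> U then shift (\<delta> \<alpha>) (g (\<pi> \<alpha>)) else (\<lambda>_. 0))" for \<alpha>
  have gsm: "sm s (g \<beta>)" if "\<beta> \<in> B" for \<beta>
    by (rule sm_mono[OF hsm[OF that]]) (simp add: g_def)
  have Gtri: "N \<alpha> < N \<gamma>" if "G \<alpha> \<gamma> \<noteq> 0" for \<alpha> \<gamma>
  proof -
    have U: "\<alpha> \<in> U" and le: "\<delta> \<alpha> \<le> \<gamma>" and nz: "g (\<pi> \<alpha>) (\<lambda>i. \<gamma> i - \<delta> \<alpha> i) \<noteq> 0"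
      using that by (auto simp: G_def shift_def split: if_splits)
    have "N (\<pi> \<alpha>) < N (\<lambda>i. \<gamma> i - \<delta> \<alpha> i)"
      using nz by (intro hlead[OF \<pi>(1)[OF U]]) (auto simp: g_def split: if_splits)
    then have "N (\<delta> \<alpha>) * N (\<pi> \<alpha>) < N (\<delta> \<alpha>) * N (\<lambda>i. \<gamma> i - \<delta> \<alpha> i)"
      using N_pos by simp
    also have "N (\<delta> \<alpha>) * N (\<pi> \<alpha>) = N \<alpha>"
      unfolding N_add[symmetric] using \<delta>[OF U] by simp
    also have "N (\<delta> \<alpha>) * N (\<lambda>i. \<gamma> i - \<delta> \<alpha> i) = N \<gamma>"
      unfolding N_add[symmetric] using le by (simp add: le_fun_def)
    finally show ?thesis .
  qed
  have Gsum: "\<exists>S\<le>wt s \<alpha> / 2. ((\<lambda>\<gamma>. \<bar>G \<alpha> \<gamma>\<bar> * wt s \<gamma>) has_sum S) UNIV" for \<alpha>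
  proof (cases "\<alpha> \<in> U")
    case True
    have "((\<lambda>\<gamma>. \<bar>g (\<pi> \<alpha>) \<gamma>\<bar> * wt s \<gamma>) has_sum nrm s (g (\<pi> \<alpha>))) UNIV"
      using gsm[OF \<pi>(1)[OF True]] by (simp add: sm_def nrm_def)
    then have "((\<lambda>\<gamma>. shift (\<delta> \<alpha>) (\<lambda>\<gamma>. \<bar>g (\<pi> \<alpha>) \<gamma>\<bar>) \<gamma> * wt s \<gamma>) has_sum
        (wt s (\<delta> \<alpha>) * nrm s (g (\<pi> \<alpha>)))) UNIV"
      by (rule has_sum_shift[where \<phi> = "wt s", OF wt_add])
    moreover have "shift (\<delta> \<alpha>) (\<lambda>\<gamma>. \<bar>g (\<pi> \<alpha>) \<gamma>\<bar>) \<gamma> = \<bar>G \<alpha> \<gamma>\<bar>" for \<gamma>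
      using True by (simp add: G_def shift_def)
    moreover have "wt s (\<delta> \<alpha>) * nrm s (g (\<pi> \<alpha>)) \<le> wt s (\<delta> \<alpha>) * (wt s (\<pi> \<alpha>) / 2)"
      using htail[OF \<pi>(1)[OF True]] by (intro mult_left_mono) (auto simp: g_def)
    moreover have "wt s (\<delta> \<alpha>) * wt s (\<pi> \<alpha>) = wt s \<alpha>"
      unfolding wt_add[symmetric] using \<delta>[OF True] by simp
    ultimately show ?thesis by auto
  next
    case False
    then show ?thesis by (intro exI[of _ 0]) (simp add: G_def)
  qed
  have Gsm: "sm s (G \<alpha>)" and Gnrm: "nrm s (G \<alpha>) \<le> wt s \<alpha> / 2" for \<alpha>
    using Gsum[of \<alpha>] by (auto simp: sm_def nrm_def summable_on_def dest: infsumI)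
  have contr: "(\<Sum>\<gamma>\<in>F. \<bar>G \<alpha> \<gamma>\<bar> * wt s \<gamma>) \<le> wt s \<alpha> / 2" if "finite F" for \<alpha> F
  proof -
    have "(\<Sum>\<gamma>\<in>F. \<bar>G \<alpha> \<gamma>\<bar> * wt s \<gamma>) \<le> nrm s (G \<alpha>)"
      using Gsm[of \<alpha>] that unfolding nrm_def sm_def by (intro finite_sum_le_infsum) auto
    then show ?thesis using Gnrm[of \<alpha>] by linarith
  qed
  have afin: "(\<Sum>\<gamma>\<in>F. \<bar>a \<gamma>\<bar> * wt s \<gamma>) \<le> nrm s a" if "finite F" for F
    using asm that unfolding nrm_def sm_def by (intro finite_sum_le_infsum) auto
  obtain b where b0: "\<And>\<gamma>. \<gamma> \<notin> U \<Longrightarrow> b \<gamma> = 0"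
    and bU: "\<And>\<gamma>. \<gamma> \<in> U \<Longrightarrow> b \<gamma> + (\<Sum>\<alpha> | N \<alpha> < N \<gamma>. b \<alpha> * G \<alpha> \<gamma>) = a \<gamma>"
    and bfin: "\<And>F. finite F \<Longrightarrow> (\<Sum>\<gamma>\<in>F. \<bar>b \<gamma>\<bar> * wt s \<gamma>) \<le> 2 * nrm s a"
    using triangular_solution[OF finite_N_less wt_nonneg contr afin, of U] by blast
  have bsm: "sm s b"
    unfolding sm_def
  proof (rule nonneg_bdd_above_summable_on)
    show "bdd_above (sum (\<lambda>\<alpha>. \<bar>b \<alpha>\<bar> * wt s \<alpha>) ` {F. F \<subseteq> UNIV \<and> finite F})"
      by (rule bdd_aboveI[of _ "2 * nrm s a"]) (use bfin in auto)
  qed auto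
  have bnrm: "nrm s b \<le> 2 * nrm s a"
    using bsm bfin unfolding nrm_def sm_def by (intro infsum_le_finite_sums) auto
  have bGeq: "(\<Sum>\<^sub>\<infinity>\<alpha>. b \<alpha> * G \<alpha> \<gamma>) = (\<Sum>\<alpha> | N \<alpha> < N \<gamma>. b \<alpha> * G \<alpha> \<gamma>)" for \<gamma>
  proof -
    have "(\<Sum>\<^sub>\<infinity>\<alpha>. b \<alpha> * G \<alpha> \<gamma>) = (\<Sum>\<^sub>\<infinity>\<alpha>\<in>{\<alpha>. N \<alpha> < N \<gamma>}. b \<alpha> * G \<alpha> \<gamma>)"
      by (rule infsum_cong_neutral) (use Gtri in auto)
    then show ?thesis using finite_N_less by simp
  qed
  define T where "T \<gamma> = (\<Sum>\<^sub>\<infinity>\<alpha>. b \<alpha> * G \<alpha> \<gamma>)" for \<gamma>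
  \<comment> \<open>Joint absolute summability justifies both interchanges of sums below: for the
    norm of \<open>T\<close>, and, since
    \<open>\<bar>pw y \<gamma>\<bar> \<le> wt s \<gamma>\<close>, for its value at
    \<open>y\<close>.\<close>
  have prodsm: "(\<lambda>x. norm (case x of (\<alpha>, \<gamma>) \<Rightarrow> b \<alpha> * G \<alpha> \<gamma> * wt s \<gamma>)) summable_on UNIV \<times> UNIV"
    unfolding Infinite_Sum.abs_summable_on_Sigma_iff
  proof (intro conjI ballI)
    have eq: "norm (case (\<alpha>, \<gamma>) of (\<alpha>, \<gamma>) \<Rightarrow> b \<alpha> * G \<alpha> \<gamma> * wt s \<gamma>) =
        \<bar>b \<alpha>\<bar> * (\<bar>G \<alpha> \<gamma>\<bar> * wt s \<gamma>)" for \<alpha> \<gamma>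
      by (simp add: abs_mult)
    show "(\<lambda>\<gamma>. norm (case (\<alpha>, \<gamma>) of (\<alpha>, \<gamma>) \<Rightarrow> b \<alpha> * G \<alpha> \<gamma> * wt s \<gamma>)) summable_on UNIV" for \<alpha>
      unfolding eq using Gsm[of \<alpha>] unfolding sm_def by (rule summable_on_cmult_right)
    have "(\<Sum>\<^sub>\<infinity>\<gamma>. norm (case (\<alpha>, \<gamma>) of (\<alpha>, \<gamma>) \<Rightarrow> b \<alpha> * G \<alpha> \<gamma> * wt s \<gamma>)) = \<bar>b \<alpha>\<bar> * nrm s (G \<alpha>)" for \<alpha>
      unfolding eq nrm_def by (rule infsum_cmult_right')
    moreover have "(\<lambda>\<alpha>. norm (\<bar>b \<alpha>\<bar> * nrm s (G \<alpha>))) summable_on UNIV"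
    proof (rule Infinite_Sum.abs_summable_on_comparison_test'[of "\<lambda>\<alpha>. \<bar>b \<alpha>\<bar> * wt s \<alpha>"])
      show "(\<lambda>\<alpha>. \<bar>b \<alpha>\<bar> * wt s \<alpha>) summable_on UNIV" using bsm by (simp add: sm_def)
      have "nrm s (G \<alpha>) \<le> wt s \<alpha>" for \<alpha> using Gnrm[of \<alpha>] wt_nonneg[of s \<alpha>] by linarith
      then show "norm (\<bar>b \<alpha>\<bar> * nrm s (G \<alpha>)) \<le> \<bar>b \<alpha>\<bar> * wt s \<alpha>" for \<alpha>
        by (simp add: abs_mult nrm_nonneg mult_left_mono)
    qed
    ultimately show "(\<lambda>\<alpha>. norm (\<Sum>\<^sub>\<infinity>\<gamma>. norm (case (\<alpha>, \<gamma>) of (\<alpha>, \<gamma>) \<Rightarrow> b \<alpha> * G \<alpha> \<gamma> * wt s \<gamma>)))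
        summable_on UNIV"
      by simp
  qed
  have Tsm: "sm s T"
  proof -
    have "(\<lambda>x. norm (case x of (\<gamma>, \<alpha>) \<Rightarrow> b \<alpha> * G \<alpha> \<gamma> * wt s \<gamma>)) summable_on UNIV \<times> UNIV"
      using prodsm summable_on_swap[of "\<lambda>(\<gamma>, \<alpha>). norm (b \<alpha> * G \<alpha> \<gamma> * wt s \<gamma>)" UNIV UNIV]
      by (simp add: case_prod_beta')
    then have "(\<lambda>(\<gamma>, \<alpha>). b \<alpha> * G \<alpha> \<gamma> * wt s \<gamma>) summable_on UNIV \<times> UNIV"
      by (rule abs_summable_summable)
    then have "(\<lambda>\<gamma>. \<Sum>\<^sub>\<infinity>\<alpha>. b \<alpha> * G \<alpha> \<gamma> * wt s \<gamma>) summable_on UNIV"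
      by (rule summable_on_Sigma_banach[where f = "\<lambda>\<gamma> \<alpha>. b \<alpha> * G \<alpha> \<gamma> * wt s \<gamma>"])
    then have "(\<lambda>\<gamma>. T \<gamma> * wt s \<gamma>) summable_on UNIV"
      unfolding T_def infsum_cmult_left' .
    then have "(\<lambda>\<gamma>. norm (T \<gamma> * wt s \<gamma>)) summable_on UNIV"
      by (rule summable_on_iff_abs_summable_on_real[THEN iffD1])
    then show ?thesis by (simp add: sm_def abs_mult)
  qed
  \<comment> \<open>\<open>b + T\<close> is the combination of the shifted divisors. By the equation
    for \<open>b\<close> it equals \<open>a\<close> on \<open>U\<close>, so \<open>r\<close>
    vanishes there.\<close>
  define r where "r \<gamma> = a \<gamma> - b \<gamma> - T \<gamma>" for \<gamma>
  show thesis
  proof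
    show "sm s r"
    proof -
      have "(\<lambda>\<gamma>. \<bar>a \<gamma>\<bar> * wt s \<gamma> + \<bar>b \<gamma>\<bar> * wt s \<gamma> + \<bar>T \<gamma>\<bar> * wt s \<gamma>) summable_on UNIV"
        using asm bsm Tsm unfolding sm_def by (intro summable_on_add)
      then show ?thesis unfolding sm_def
      proof (rule summable_on_comparison_test)
        show "\<bar>r \<gamma>\<bar> * wt s \<gamma> \<le> \<bar>a \<gamma>\<bar> * wt s \<gamma> + \<bar>b \<gamma>\<bar> * wt s \<gamma> + \<bar>T \<gamma>\<bar> * wt s \<gamma>" for \<gamma>
          unfolding distrib_right[symmetric] by (rule mult_right_mono) (auto simp: r_def)
      qed auto
    qed
    show "r \<gamma> = 0" if "\<exists>\<beta>\<in>B. \<beta> \<le> \<gamma>" for \<gamma>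
      using bU[of \<gamma>] that by (auto simp: r_def T_def bGeq U_def)
    fix y assume y: "y \<in> polydisc s"
    let ?C = "\<Sum>\<beta>\<in>B. \<bar>ev (h \<beta>) y\<bar> / wt s \<beta>"
    have "(\<lambda>x. norm (case x of (\<alpha>, \<gamma>) \<Rightarrow> b \<alpha> * G \<alpha> \<gamma> * pw y \<gamma>)) summable_on UNIV \<times> UNIV"
    proof (rule Infinite_Sum.abs_summable_on_comparison_test[OF prodsm])
      show "norm (case x of (\<alpha>, \<gamma>) \<Rightarrow> b \<alpha> * G \<alpha> \<gamma> * pw y \<gamma>) \<le>
          norm (case x of (\<alpha>, \<gamma>) \<Rightarrow> b \<alpha> * G \<alpha> \<gamma> * wt s \<gamma>)" for x
        using abs_pw_le[OF y] by (auto simp: abs_mult split: prod.splits intro!: mult_left_mono)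
    qed
    then have sw: "(\<lambda>(\<alpha>, \<gamma>). b \<alpha> * G \<alpha> \<gamma> * pw y \<gamma>) summable_on UNIV \<times> UNIV"
      by (rule abs_summable_summable)
    have "ev T y = (\<Sum>\<^sub>\<infinity>\<gamma>. \<Sum>\<^sub>\<infinity>\<alpha>. b \<alpha> * G \<alpha> \<gamma> * pw y \<gamma>)"
      unfolding ev_def T_def infsum_cmult_left' ..
    also have "\<dots> = (\<Sum>\<^sub>\<infinity>\<alpha>. \<Sum>\<^sub>\<infinity>\<gamma>. b \<alpha> * G \<alpha> \<gamma> * pw y \<gamma>)"
      using infsum_swap_banach[OF sw] by simp
    also have "\<dots> = (\<Sum>\<^sub>\<infinity>\<alpha>. b \<alpha> * ev (G \<alpha>) y)"
      unfolding ev_def mult.assoc infsum_cmult_right' ..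
    finally have evT: "ev T y = (\<Sum>\<^sub>\<infinity>\<alpha>. b \<alpha> * ev (G \<alpha>) y)" .
    have bGs: "(\<lambda>\<alpha>. b \<alpha> * ev (G \<alpha>) y) summable_on UNIV"
      using summable_on_Sigma_banach[OF sw] unfolding ev_def mult.assoc infsum_cmult_right' .
    have "ev r y = ev a y - ev b y - ev T y"
    proof -
      have "((\<lambda>\<gamma>. a \<gamma> * pw y \<gamma> - b \<gamma> * pw y \<gamma> - T \<gamma> * pw y \<gamma>) has_sum
          (ev a y - ev b y - ev T y)) UNIV"
        unfolding ev_def
        by (intro has_sum_diff has_sum_infsum ev_summable[OF _ y] asm bsm Tsm)
      then show ?thesis unfolding ev_def[of r] by (intro infsumI) (simp add: r_def left_diff_distrib)
    qed
    then have "ev a y - ev r y = ev b y + (\<Sum>\<^sub>\<infinity>\<alpha>. b \<alpha> * ev (G \<alpha>) y)"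
      by (simp add: evT)
    also have "\<dots> = (\<Sum>\<^sub>\<infinity>\<alpha>. b \<alpha> * (pw y \<alpha> + ev (G \<alpha>) y))"
      unfolding ev_def[of b] distrib_left
      by (rule infsum_add[symmetric, OF ev_summable[OF bsm y] bGs])
    finally have eq: "ev a y - ev r y = (\<Sum>\<^sub>\<infinity>\<alpha>. b \<alpha> * (pw y \<alpha> + ev (G \<alpha>) y))" .
    have C0: "?C \<ge> 0" by (intro sum_nonneg) auto
    \<comment> \<open>Putting the monomial and \<open>G \<alpha>\<close> back together restores the
      full divisor: on \<open>U\<close> the bracket is
      \<open>pw y (\<delta> \<alpha>) * ev (h (\<pi> \<alpha>)) y\<close>, so the bound involves the
      values of the divisors and not the size of their tails.\<close>
    have le: "norm (b \<alpha> * (pw y \<alpha> + ev (G \<alpha>) y)) \<le> \<bar>b \<alpha>\<bar> * wt s \<alpha> * ?C" for \<alpha>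
    proof (cases "\<alpha> \<in> U")
      case True
      note pB = \<pi>(1)[OF True]
      have "((\<lambda>\<gamma>. shift (\<delta> \<alpha>) (g (\<pi> \<alpha>)) \<gamma> * pw y \<gamma>) has_sum (pw y (\<delta> \<alpha>) * ev (g (\<pi> \<alpha>)) y)) UNIV"
        using ev_summable[OF gsm[OF pB] y] by (intro has_sum_shift[where \<phi> = "pw y", OF pw_add]) (simp add: ev_def)
      then have "ev (G \<alpha>) y = pw y (\<delta> \<alpha>) * ev (g (\<pi> \<alpha>)) y"
        using True by (simp add: ev_def G_def infsumI)
      moreover have "pw y \<alpha> = pw y (\<delta> \<alpha>) * pw y (\<pi> \<alpha>)"
        unfolding pw_add[symmetric] using \<delta>[OF True] by simp
      moreover have "ev (h (\<pi> \<alpha>)) y = pw y (\<pi> \<alpha>) + ev (g (\<pi> \<alpha>)) y"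
      proof -
        let ?e = "\<lambda>\<gamma>. if \<gamma> = \<pi> \<alpha> then pw y \<gamma> else 0"
        have e: "(?e has_sum pw y (\<pi> \<alpha>)) UNIV"
          by (rule has_sum_finite_neutralI[of "{\<pi> \<alpha>}"]) auto
        have "h (\<pi> \<alpha>) \<gamma> * pw y \<gamma> = ?e \<gamma> + g (\<pi> \<alpha>) \<gamma> * pw y \<gamma>" for \<gamma>
          using h1[OF pB] by (simp add: g_def)
        then have "ev (h (\<pi> \<alpha>)) y = (\<Sum>\<^sub>\<infinity>\<gamma>. ?e \<gamma> + g (\<pi> \<alpha>) \<gamma> * pw y \<gamma>)"
          by (simp only: ev_def)
        also have "\<dots> = infsum ?e UNIV + ev (g (\<pi> \<alpha>)) y"
          unfolding ev_def using e ev_summable[OF gsm[OF pB] y]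
          by (intro infsum_add) (auto simp: summable_on_def)
        finally show ?thesis using e by (simp add: infsumI)
      qed
      ultimately have "pw y \<alpha> + ev (G \<alpha>) y = pw y (\<delta> \<alpha>) * ev (h (\<pi> \<alpha>)) y"
        by (simp add: distrib_left)
      then have "\<bar>pw y \<alpha> + ev (G \<alpha>) y\<bar> \<le> wt s (\<delta> \<alpha>) * \<bar>ev (h (\<pi> \<alpha>)) y\<bar>"
        using abs_pw_le[OF y] by (simp add: abs_mult mult_right_mono)
      also have "\<dots> = wt s \<alpha> * (\<bar>ev (h (\<pi> \<alpha>)) y\<bar> / wt s (\<pi> \<alpha>))"
      proof -
        have "wt s \<alpha> = wt s (\<delta> \<alpha>) * wt s (\<pi> \<alpha>)"
          unfolding wt_add[symmetric] using \<delta>[OF True] by simp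
        then show ?thesis using wt_pos[of s "\<pi> \<alpha>"] by simp
      qed
      also have "\<dots> \<le> wt s \<alpha> * ?C"
        using pB B by (intro mult_left_mono member_le_sum) auto
      finally show ?thesis by (simp add: abs_mult mult.assoc mult_left_mono)
    qed (use b0 in simp)
    have bw: "(\<lambda>\<alpha>. \<bar>b \<alpha>\<bar> * wt s \<alpha> * ?C) summable_on UNIV"
      using bsm unfolding sm_def by (rule summable_on_cmult_left)
    have "\<bar>ev a y - ev r y\<bar> \<le> (\<Sum>\<^sub>\<infinity>\<alpha>. \<bar>b \<alpha>\<bar> * wt s \<alpha> * ?C)"
    proof -
      have "\<bar>\<Sum>\<^sub>\<infinity>\<alpha>. b \<alpha> * (pw y \<alpha> + ev (G \<alpha>) y)\<bar> \<le> (\<Sum>\<^sub>\<infinity>\<alpha>. \<bar>b \<alpha>\<bar> * wt s \<alpha> * ?C)"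
        using norm_infsum_le[OF has_sum_infsum has_sum_infsum[OF bw], of "\<lambda>\<alpha>. b \<alpha> * (pw y \<alpha> + ev (G \<alpha>) y)"]
          abs_summable_summable[OF Infinite_Sum.abs_summable_on_comparison_test'[OF bw le]] le
        by simp
      then show ?thesis unfolding eq .
    qed
    also have "\<dots> = nrm s b * ?C"
      unfolding nrm_def by (rule infsum_cmult_left')
    also have "\<dots> \<le> 2 * nrm s a * ?C"
      using bnrm C0 by (rule mult_right_mono)
    finally show "\<bar>ev a y - ev r y\<bar> \<le> 2 * nrm s a * ?C" .
  qed
qed

subsection \<open>The Bautin estimate\<close>

text \<open>The leading exponent of a local order: the smallest \<open>N\<close> in the support,
  hence the largest weight.\<close>

definition leads :: "(('n \<Rightarrow> nat) \<Rightarrow> real) \<Rightarrow> ('n \<Rightarrow> nat) \<Rightarrow> bool" where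
  "leads c \<beta> \<longleftrightarrow> c \<beta> \<noteq> 0 \<and> (\<forall>\<gamma>. c \<gamma> \<noteq> 0 \<longrightarrow> \<gamma> \<noteq> \<beta> \<longrightarrow> N \<beta> < N \<gamma>)"

lemma leads_exists:
  assumes "c \<alpha> \<noteq> 0"
  shows "\<exists>\<beta>. leads c \<beta>"
proof -
  obtain \<beta> where b: "c \<beta> \<noteq> 0" "\<And>\<gamma>. c \<gamma> \<noteq> 0 \<Longrightarrow> N \<beta> \<le> N \<gamma>"
    using ex_has_least_nat[of "\<lambda>\<alpha>. c \<alpha> \<noteq> 0" \<alpha> N] assms by blast
  have "N \<beta> < N \<gamma>" if "c \<gamma> \<noteq> 0" "\<gamma> \<noteq> \<beta>" for \<gamma>
    using b(2)[OF that(1)] N_inj[of \<beta> \<gamma>] that(2) by (cases "N \<beta> = N \<gamma>") auto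
  then show ?thesis using b(1) unfolding leads_def by blast
qed

text \<open>Small polydiscs favour the leading monomial, since it has the smallest \<open>N\<close>.\<close>

lemma eventually_tail_le:
  assumes sm: "sm s0 h" and l: "leads h \<beta>"
  shows "\<forall>\<^sub>F s in sequentially. nrm s (h(\<beta> := 0)) \<le> wt s \<beta> / 2"
proof -
  define g where "g = h(\<beta> := 0)"
  have gsm: "sm s0 g" by (rule sm_mono[OF sm]) (simp add: g_def)
  \<comment> \<open>Every other exponent of the support has \<open>N\<close> at least
    \<open>Suc (N \<beta>)\<close>; so \<open>q\<close> bounds what its weight loses against that of
    \<beta> each time \<open>s\<close> grows by 1.\<close>
  define q where "q = real (N \<beta>) / real (Suc (N \<beta>))"
  have q: "0 \<le> q" "q < 1" by (auto simp: q_def)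
  have "(\<lambda>k. nrm s0 g * q ^ k) \<longlonglongrightarrow> nrm s0 g * 0"
    using q by (intro tendsto_mult tendsto_const LIMSEQ_realpow_zero)
  then have "\<forall>\<^sub>F k in sequentially. nrm s0 g * q ^ k < wt s0 \<beta> / 2"
    using wt_pos[of s0 \<beta>] by (intro order_tendstoD(2)) auto
  then obtain k0 where k0: "\<And>k. k \<ge> k0 \<Longrightarrow> nrm s0 g * q ^ k < wt s0 \<beta> / 2"
    unfolding eventually_sequentially by blast
  have "nrm s g \<le> wt s \<beta> / 2" if "s \<ge> s0 + k0" for s
  proof -
    define k where "k = s - s0"
    have s: "s = s0 + k" "k \<ge> k0" using that by (auto simp: k_def)
    let ?x = "1 / real (Suc (N \<beta>))"
    have le: "\<bar>g \<gamma>\<bar> * wt s \<gamma> \<le> \<bar>g \<gamma>\<bar> * wt s0 \<gamma> * ?x ^ k" for \<gamma>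
    proof (cases "g \<gamma> = 0")
      case False
      then have "N \<beta> < N \<gamma>" using l by (auto simp: g_def leads_def split: if_splits)
      then have "1 / real (N \<gamma>) \<le> ?x" by (intro divide_left_mono) auto
      then have "(1 / real (N \<gamma>)) ^ k \<le> ?x ^ k" by (intro power_mono) auto
      moreover have "wt s \<gamma> = wt s0 \<gamma> * (1 / real (N \<gamma>)) ^ k"
        by (simp add: wt_def s power_add power_divide)
      ultimately have "wt s \<gamma> \<le> wt s0 \<gamma> * ?x ^ k" by (simp only: mult_left_mono wt_nonneg)
      then show ?thesis unfolding mult.assoc by (rule mult_left_mono) simp
    qed simp
    have "nrm s g \<le> (\<Sum>\<^sub>\<infinity>\<gamma>. \<bar>g \<gamma>\<bar> * wt s0 \<gamma> * ?x ^ k)"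
      unfolding nrm_def
    proof (rule infsum_mono)
      show "(\<lambda>\<gamma>. \<bar>g \<gamma>\<bar> * wt s \<gamma>) summable_on UNIV"
        using sm_antimono[OF gsm, of s] s by (simp add: sm_def)
      show "(\<lambda>\<gamma>. \<bar>g \<gamma>\<bar> * wt s0 \<gamma> * ?x ^ k) summable_on UNIV"
        using gsm unfolding sm_def by (rule summable_on_cmult_left)
    qed (rule le)
    also have "\<dots> = nrm s0 g * ?x ^ k" unfolding nrm_def by (rule infsum_cmult_left')
    also have "\<dots> = nrm s0 g * q ^ k * (1 / real (N \<beta>)) ^ k"
      using N_pos[of \<beta>] by (simp add: q_def power_divide)
    also have "\<dots> \<le> wt s0 \<beta> / 2 * (1 / real (N \<beta>)) ^ k"
      using k0[OF s(2)] by (intro mult_right_mono) auto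
    also have "\<dots> = wt s \<beta> / 2"
      by (simp add: wt_def s power_add power_divide)
    finally show ?thesis .
  qed
  then show ?thesis unfolding eventually_sequentially g_def by blast
qed

text \<open>
  The germs dominated near 0 by finitely many of the \<open>a k\<close> form an ideal containing every
  \<open>a k\<close>; this replaces the ideal generated by the \<open>a k\<close>, and avoids the ring structure on
  convergent power series.
\<close>

definition dominated :: "(nat \<Rightarrow> ('n \<Rightarrow> nat) \<Rightarrow> real) \<Rightarrow> (('n \<Rightarrow> nat) \<Rightarrow> real) \<Rightarrow> bool" where
  "dominated a c \<longleftrightarrow> (\<exists>K\<ge>0. \<exists>d. \<forall>\<^sub>F s in sequentially. sm s c \<and>
     (\<forall>y\<in>polydisc s. \<bar>ev c y\<bar> \<le> K * (\<Sum>j\<le>d. \<bar>ev (a j) y\<bar>)))"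

lemma dominatedI:
  assumes "K \<ge> 0" "\<forall>\<^sub>F s in sequentially. sm s c \<and>
    (\<forall>y\<in>polydisc s. \<bar>ev c y\<bar> \<le> K * (\<Sum>j\<le>d. \<bar>ev (a j) y\<bar>))"
  shows "dominated a c"
  using assms unfolding dominated_def by blast

lemma dominated_cmult:
  assumes "dominated a c"
  shows "dominated a (\<lambda>\<alpha>. k * c \<alpha>)"
proof -
  from assms obtain K d where K: "K \<ge> 0" and ev: "\<forall>\<^sub>F s in sequentially. sm s c \<and>
     (\<forall>y\<in>polydisc s. \<bar>ev c y\<bar> \<le> K * (\<Sum>j\<le>d. \<bar>ev (a j) y\<bar>))"
    unfolding dominated_def by blast
  have "\<forall>\<^sub>F s in sequentially. sm s (\<lambda>\<alpha>. k * c \<alpha>) \<and>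
     (\<forall>y\<in>polydisc s. \<bar>ev (\<lambda>\<alpha>. k * c \<alpha>) y\<bar> \<le> \<bar>k\<bar> * K * (\<Sum>j\<le>d. \<bar>ev (a j) y\<bar>))"
    using ev by eventually_elim (auto simp: ev_cmult abs_mult mult.assoc intro: sm_cmult mult_left_mono)
  then show ?thesis by (rule dominatedI[rotated]) (simp add: K)
qed

text \<open>Divide \<open>a k\<close> by germs whose leading exponents generate \<open>L\<close>.
  The remainder differs from \<open>a k\<close> by something controlled by the divisors, so it is
  dominated too; if it were nonzero, its leading exponent would lie in \<open>L\<close>, hence above
  an element of \<open>B\<close>, where its coefficients vanish. So the remainder is zero and the
  division bound is the claim.\<close>

lemma Bautin_estimate:
  fixes a :: "nat \<Rightarrow> ('n \<Rightarrow> nat) \<Rightarrow> real"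
  assumes asm: "\<And>k. sm s0 (a k)" and anrm: "\<And>k. nrm s0 (a k) \<le> C * M ^ k" and M: "M > 0"
  shows "\<exists>s\<ge>s0. \<exists>d K. K > 0 \<and>
    (\<forall>k. \<forall>y\<in>polydisc s. \<bar>ev (a k) y\<bar> \<le> K * M ^ k * (\<Sum>j\<le>d. \<bar>ev (a j) y\<bar>))"
proof -
  have adom: "dominated a (a k)" for k
  proof (rule dominatedI)
    show "\<forall>\<^sub>F s in sequentially. sm s (a k) \<and>
      (\<forall>y\<in>polydisc s. \<bar>ev (a k) y\<bar> \<le> 1 * (\<Sum>j\<le>k. \<bar>ev (a j) y\<bar>))"
      using eventually_ge_at_top[of s0]
      by eventually_elim (auto intro: sm_antimono[OF asm] member_le_sum)
  qed simp
  define L where "L = {\<beta>. \<exists>c. dominated a c \<and> leads c \<beta>}"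
  obtain B where B: "finite B" "B \<subseteq> L" "\<forall>\<alpha>\<in>L. \<exists>\<beta>\<in>B. \<beta> \<le> \<alpha>"
    using Dickson[of L] by blast
  have "\<exists>c. dominated a c \<and> leads c \<beta> \<and> c \<beta> = 1" if "\<beta> \<in> B" for \<beta>
  proof -
    from that B obtain c where c: "dominated a c" "leads c \<beta>" by (auto simp: L_def)
    have "leads (\<lambda>\<alpha>. (1 / c \<beta>) * c \<alpha>) \<beta>" using c(2) by (auto simp: leads_def)
    moreover have "(1 / c \<beta>) * c \<beta> = 1" using c(2) by (auto simp: leads_def)
    ultimately show ?thesis using dominated_cmult[OF c(1)] by blast
  qed
  then obtain h where h: "\<And>\<beta>. \<beta> \<in> B \<Longrightarrow> dominated a (h \<beta>)" "\<And>\<beta>. \<beta> \<in> B \<Longrightarrow> leads (h \<beta>) \<beta>"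
    "\<And>\<beta>. \<beta> \<in> B \<Longrightarrow> h \<beta> \<beta> = 1"
    by metis
  have "\<forall>\<beta>\<in>B. \<exists>K d. K \<ge> 0 \<and> (\<forall>\<^sub>F s in sequentially. sm s (h \<beta>) \<and>
      (\<forall>y\<in>polydisc s. \<bar>ev (h \<beta>) y\<bar> \<le> K * (\<Sum>j\<le>d. \<bar>ev (a j) y\<bar>)))"
    using h(1) unfolding dominated_def by blast
  from bchoice[OF this] obtain Kh where "\<forall>\<beta>\<in>B. \<exists>d. Kh \<beta> \<ge> 0 \<and> (\<forall>\<^sub>F s in sequentially. sm s (h \<beta>) \<and>
      (\<forall>y\<in>polydisc s. \<bar>ev (h \<beta>) y\<bar> \<le> Kh \<beta> * (\<Sum>j\<le>d. \<bar>ev (a j) y\<bar>)))" ..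
  from bchoice[OF this] obtain dh where Kh: "\<And>\<beta>. \<beta> \<in> B \<Longrightarrow> Kh \<beta> \<ge> 0"
    and hev: "\<And>\<beta>. \<beta> \<in> B \<Longrightarrow> \<forall>\<^sub>F s in sequentially. sm s (h \<beta>) \<and>
      (\<forall>y\<in>polydisc s. \<bar>ev (h \<beta>) y\<bar> \<le> Kh \<beta> * (\<Sum>j\<le>dh \<beta>. \<bar>ev (a j) y\<bar>))"
    by blast
  have tail: "\<forall>\<^sub>F s in sequentially. nrm s ((h \<beta>)(\<beta> := 0)) \<le> wt s \<beta> / 2" if "\<beta> \<in> B" for \<beta>
  proof -
    obtain s1 where "sm s1 (h \<beta>)"
      using hev[OF \<open>\<beta> \<in> B\<close>] unfolding eventually_sequentially by blast
    then show ?thesis using h(2)[OF \<open>\<beta> \<in> B\<close>] by (rule eventually_tail_le)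
  qed
  have "\<forall>\<^sub>F s in sequentially. \<forall>\<beta>\<in>B. (sm s (h \<beta>) \<and>
      (\<forall>y\<in>polydisc s. \<bar>ev (h \<beta>) y\<bar> \<le> Kh \<beta> * (\<Sum>j\<le>dh \<beta>. \<bar>ev (a j) y\<bar>))) \<and>
      nrm s ((h \<beta>)(\<beta> := 0)) \<le> wt s \<beta> / 2"
    by (intro eventually_ball_finite[OF B(1)] ballI eventually_conj hev tail)
  then obtain s1 where s1: "\<And>s. s \<ge> s1 \<Longrightarrow> \<forall>\<beta>\<in>B. (sm s (h \<beta>) \<and>
      (\<forall>y\<in>polydisc s. \<bar>ev (h \<beta>) y\<bar> \<le> Kh \<beta> * (\<Sum>j\<le>dh \<beta>. \<bar>ev (a j) y\<bar>))) \<and>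
      nrm s ((h \<beta>)(\<beta> := 0)) \<le> wt s \<beta> / 2"
    unfolding eventually_sequentially by blast
  \<comment> \<open>Fixed before any \<open>k\<close> is considered, so that \<open>d\<close> and
    \<open>Kd s\<close> serve all \<open>k\<close>.\<close>
  define s where "s = max s0 s1"
  have ss: "s \<ge> s0" "s \<ge> s1" by (auto simp: s_def)
  define d where "d = (\<Sum>\<beta>\<in>B. dh \<beta>)"
  define Kd where "Kd t = (\<Sum>\<beta>\<in>B. Kh \<beta> / wt t \<beta>)" for t
  have hle: "\<bar>ev (h \<beta>) y\<bar> \<le> Kh \<beta> * (\<Sum>j\<le>d. \<bar>ev (a j) y\<bar>)"
    if "\<beta> \<in> B" "y \<in> polydisc t" "t \<ge> s1" for \<beta> y t
  proof -
    have "dh \<beta> \<le> d" unfolding d_def using B(1) that(1) by (intro member_le_sum) auto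
    then have "(\<Sum>j\<le>dh \<beta>. \<bar>ev (a j) y\<bar>) \<le> (\<Sum>j\<le>d. \<bar>ev (a j) y\<bar>)"
      by (intro sum_mono2) auto
    then have "Kh \<beta> * (\<Sum>j\<le>dh \<beta>. \<bar>ev (a j) y\<bar>) \<le> Kh \<beta> * (\<Sum>j\<le>d. \<bar>ev (a j) y\<bar>)"
      using Kh[OF that(1)] by (rule mult_left_mono)
    then show ?thesis using s1[OF that(3)] that order_trans by blast
  qed
  have hsum: "(\<Sum>\<beta>\<in>B. \<bar>ev (h \<beta>) y\<bar> / wt t \<beta>) \<le> Kd t * (\<Sum>j\<le>d. \<bar>ev (a j) y\<bar>)"
    if "y \<in> polydisc u" "u \<ge> s1" for y t u
    unfolding Kd_def sum_distrib_right
  proof (rule sum_mono)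
    fix \<beta> assume "\<beta> \<in> B"
    then have "\<bar>ev (h \<beta>) y\<bar> / wt t \<beta> \<le> (Kh \<beta> * (\<Sum>j\<le>d. \<bar>ev (a j) y\<bar>)) / wt t \<beta>"
      using hle that by (intro divide_right_mono) auto
    then show "\<bar>ev (h \<beta>) y\<bar> / wt t \<beta> \<le> Kh \<beta> / wt t \<beta> * (\<Sum>j\<le>d. \<bar>ev (a j) y\<bar>)" by simp
  qed
  have Kd0: "Kd s \<ge> 0" using Kh by (auto simp: Kd_def intro!: sum_nonneg divide_nonneg_nonneg)
  have main: "\<bar>ev (a k) y\<bar> \<le> 2 * nrm s (a k) * (Kd s * (\<Sum>j\<le>d. \<bar>ev (a j) y\<bar>))"
    if y: "y \<in> polydisc s" for k y
  proof -
    obtain r where r: "sm s r" "\<And>\<gamma>. \<exists>\<beta>\<in>B. \<beta> \<le> \<gamma> \<Longrightarrow> r \<gamma> = 0"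
      "\<And>y. y \<in> polydisc s \<Longrightarrow>
        \<bar>ev (a k) y - ev r y\<bar> \<le> 2 * nrm s (a k) * (\<Sum>\<beta>\<in>B. \<bar>ev (h \<beta>) y\<bar> / wt s \<beta>)"
    proof (rule division[of B h s "a k"])
      show "N \<beta> < N \<gamma>" if "\<beta> \<in> B" "h \<beta> \<gamma> \<noteq> 0" "\<gamma> \<noteq> \<beta>" for \<beta> \<gamma>
        using h(2)[OF that(1)] that by (auto simp: leads_def)
    qed (use B h(3) s1[OF ss(2)] sm_antimono[OF asm ss(1)] in auto)
    have bnd: "\<bar>ev (a k) z - ev r z\<bar> \<le> 2 * nrm s (a k) * (Kd s * (\<Sum>j\<le>d. \<bar>ev (a j) z\<bar>))"
      if "z \<in> polydisc s" for z
      using r(3)[OF that] hsum[OF that ss(2), of s] nrm_nonneg[of s "a k"]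
      by (meson mult_left_mono mult_nonneg_nonneg order_trans zero_le_numeral)
    have "dominated a r"
    proof (rule dominatedI)
      show "0 \<le> 1 + 2 * nrm s (a k) * Kd s" using Kd0 nrm_nonneg[of s "a k"] by simp
      \<comment> \<open>The index bound \<open>max k d\<close> depends on \<open>k\<close>. This is
        harmless: domination is used only to place the leading exponent of \<open>r\<close> in
        \<open>L\<close>, and \<open>r\<close> then turns out to be zero.\<close>
      show "\<forall>\<^sub>F t in sequentially. sm t r \<and> (\<forall>y\<in>polydisc t.
          \<bar>ev r y\<bar> \<le> (1 + 2 * nrm s (a k) * Kd s) * (\<Sum>j\<le>max k d. \<bar>ev (a j) y\<bar>))"
        using eventually_ge_at_top[of s]
      proof eventually_elim
        case (elim t)
        have "\<bar>ev r z\<bar> \<le> (1 + 2 * nrm s (a k) * Kd s) * (\<Sum>j\<le>max k d. \<bar>ev (a j) z\<bar>)"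
          if "z \<in> polydisc t" for z
        proof -
          have z: "z \<in> polydisc s" using polydisc_antimono[OF elim] that by blast
          let ?S = "\<Sum>j\<le>max k d. \<bar>ev (a j) z\<bar>"
          have 1: "\<bar>ev (a k) z\<bar> \<le> ?S" by (rule member_le_sum) auto
          have 2: "(\<Sum>j\<le>d. \<bar>ev (a j) z\<bar>) \<le> ?S" by (rule sum_mono2) auto
          have "2 * nrm s (a k) * (Kd s * (\<Sum>j\<le>d. \<bar>ev (a j) z\<bar>)) \<le> 2 * nrm s (a k) * (Kd s * ?S)"
            using 2 Kd0 nrm_nonneg[of s "a k"] by (intro mult_left_mono) auto
          then show ?thesis using bnd[OF z] 1 by (simp add: algebra_simps abs_le_iff)
        qed
        then show ?case using sm_antimono[OF r(1) elim] by blast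
      qed
    qed
    have "r \<gamma> = 0" for \<gamma>
    proof (rule ccontr)
      assume "r \<gamma> \<noteq> 0"
      then obtain \<beta> where b: "leads r \<beta>" using leads_exists by blast
      then have "\<beta> \<in> L" using \<open>dominated a r\<close> by (auto simp: L_def)
      then have "r \<beta> = 0" using B(3) r(2) by blast
      then show False using b by (simp add: leads_def)
    qed
    then have "ev r y = 0" by (simp add: ev_def)
    then show ?thesis using bnd[OF y] by simp
  qed
  \<comment> \<open>The absolute value spares a sign condition on \<open>C\<close>, and the summand
    1 makes \<open>K\<close> positive even if \<open>Kd s\<close> is 0.\<close>
  define K where "K = 2 * \<bar>C\<bar> * Kd s + 1"
  have "\<bar>ev (a k) y\<bar> \<le> K * M ^ k * (\<Sum>j\<le>d. \<bar>ev (a j) y\<bar>)" if "y \<in> polydisc s" for k y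
  proof -
    let ?S = "\<Sum>j\<le>d. \<bar>ev (a j) y\<bar>"
    have S: "?S \<ge> 0" by (intro sum_nonneg) auto
    have "nrm s (a k) \<le> nrm s0 (a k)" by (rule nrm_antimono[OF asm ss(1)])
    also have "\<dots> \<le> C * M ^ k" by (rule anrm)
    also have "\<dots> \<le> \<bar>C\<bar> * M ^ k" using M by (intro mult_right_mono) auto
    finally have "2 * nrm s (a k) * (Kd s * ?S) \<le> 2 * (\<bar>C\<bar> * M ^ k) * (Kd s * ?S)"
      using Kd0 S by (intro mult_right_mono mult_left_mono) auto
    also have "\<dots> = 2 * \<bar>C\<bar> * Kd s * (M ^ k * ?S)" by simp
    also have "\<dots> \<le> K * (M ^ k * ?S)"
      using M S by (intro mult_right_mono) (auto simp: K_def)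
    finally show ?thesis using main[OF that, of k] by (simp add: mult.assoc)
  qed
  moreover have "K > 0" using Kd0 by (simp add: K_def add_nonneg_pos)
  ultimately show ?thesis using ss(1) by blast
qed

end

subsection \<open>Analytic functions\<close>

lemma prime_weights_exists: "\<exists>p :: 'n::finite \<Rightarrow> nat. prime_weights p"
proof -
  obtain B :: "nat set" where B: "finite B" "card B = CARD('n)" "B \<subseteq> {q. prime q}"
    using infinite_arbitrarily_large[OF primes_infinite] by metis
  obtain p :: "'n \<Rightarrow> nat" where "p ` UNIV \<subseteq> B" "inj p"
    using card_le_inj[of "UNIV :: 'n set" B] B by auto
  then show ?thesis using B(3) by (intro exI[of _ p]) (auto simp: prime_weights_def)
qed

text \<open>Since \<alpha> has exponent 0 at the last index, that coordinate of \<open>y\<close>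
  contributes the factor 1 whatever its value. So \<open>y\<close> may lie off the hyperplane, as
  the point \<open>x0\<close> used below does.\<close>

lemma prod_with_last:
  fixes y :: "real ^ 'n::{finite,linorder}" and \<alpha> :: "'n \<Rightarrow> nat"
  assumes "\<alpha> last_index = 0"
  shows "(\<Prod>i\<in>UNIV. with_last y t $ i ^ (\<alpha>(last_index := k)) i) = (\<Prod>i\<in>UNIV. y $ i ^ \<alpha> i) * t ^ k"
proof -
  have "(\<Prod>i\<in>UNIV. with_last y t $ i ^ (\<alpha>(last_index := k)) i) =
      t ^ k * (\<Prod>i\<in>UNIV - {last_index}. with_last y t $ i ^ (\<alpha>(last_index := k)) i)"
    by (subst prod.remove[of UNIV "last_index :: 'n"]) (auto simp: with_last_def)
  also have "(\<Prod>i\<in>UNIV - {last_index}. with_last y t $ i ^ (\<alpha>(last_index := k)) i) =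
      (\<Prod>i\<in>UNIV - {last_index}. y $ i ^ \<alpha> i)"
    by (intro prod.cong) (auto simp: with_last_def)
  also have "\<dots> = (\<Prod>i\<in>UNIV. y $ i ^ \<alpha> i)"
    using assms by (subst prod.remove[of UNIV "last_index :: 'n"]) auto
  finally show ?thesis by (simp add: mult.commute)
qed

text \<open>A crude triangle inequality; its factor 2 is the origin of the halved radii
  \<open>r / 2\<close> and \<open>\<delta> i / 2\<close> in the choices of
  \<open>\<eta>\<close>.\<close>

lemma norm_with_last_less:
  fixes y :: "real ^ 'n::{finite,linorder}"
  assumes "y \<in> base_ball \<eta>" "\<bar>t\<bar> < \<eta>"
  shows "norm (with_last y t) < 2 * \<eta>"
proof -
  have "with_last y t = y + t *\<^sub>R axis last_index 1"
    using assms by (auto simp: with_last_def vec_eq_iff axis_def base_ball_def)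
  then have "norm (with_last y t) \<le> norm y + \<bar>t\<bar>"
    using norm_triangle_ineq[of y "t *\<^sub>R axis last_index 1"] by (simp add: norm_axis_1)
  then show ?thesis using assms by (simp add: base_ball_def)
qed

lemma bij_betw_update_last:
  "bij_betw (\<lambda>(k, \<alpha>). \<alpha>(last_index := k)) (UNIV \<times> {\<alpha>. \<alpha> last_index = 0})
    (UNIV :: ('n::{finite,linorder} \<Rightarrow> nat) set)"
  by (rule bij_betw_byWitness[where f' = "\<lambda>\<alpha>. (\<alpha> last_index, \<alpha>(last_index := 0))"])
    (auto simp: fun_eq_iff)

text \<open>The multi-index is split into its last entry \<open>k\<close> and the rest, and the
  coefficient of t^k is kept as a family over exponents in all n variables that vanish at the last
  index; n = 1 then needs no separate treatment. The interval \<open>J\<close> is left free so that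
  several functions can later share a smaller \<open>\<eta>\<close>.\<close>

lemma real_analytic_sublevel:
  fixes f :: "real ^ 'n::{finite,linorder} \<Rightarrow> real"
  assumes "real_analytic_at f 0"
  shows "\<exists>\<eta> m. \<eta> > 0 \<and> (\<forall>y\<in>base_ball \<eta>. \<forall>s J. is_interval J \<longrightarrow> J \<subseteq> {-\<eta><..<\<eta>} \<longrightarrow>
    union_of_at_most_intervals m {t\<in>J. f (with_last y t) < s})"
proof -
  obtain c :: "('n \<Rightarrow> nat) \<Rightarrow> real" and r where r: "r > 0"
    and f: "\<And>x. x \<in> ball 0 r \<Longrightarrow> ((\<lambda>\<alpha>. c \<alpha> * (\<Prod>i\<in>UNIV. (x $ i) ^ \<alpha> i)) has_sum f x) UNIV"
    using assms unfolding real_analytic_at_def by (simp only: zero_index diff_zero) blast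
  obtain p :: "'n \<Rightarrow> nat" where "prime_weights p"
    using prime_weights_exists by blast
  then interpret prime_weights p .
  \<comment> \<open>The point with all coordinates \<open>\<rho>\<close> has l1 norm
    \<open>r / 2\<close>, so the series converges absolutely there. Its coordinates being positive,
    it provides a majorant for every smaller polydisc.\<close>
  define \<rho> where "\<rho> = r / (2 * real CARD('n::{finite,linorder}))"
  have \<rho>: "\<rho> > 0" using r by (simp add: \<rho>_def)
  define x0 :: "real ^ 'n::{finite,linorder}" where "x0 = (\<chi> i. \<rho>)"
  have "norm x0 \<le> (\<Sum>i\<in>UNIV. \<bar>x0 $ i\<bar>)" by (rule norm_le_l1_cart)
  also have "\<dots> = r / 2" using \<rho> by (simp add: x0_def) (simp add: \<rho>_def)
  also have "\<dots> < r" using r by simp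
  finally have "x0 \<in> ball 0 r" by simp
  from f[OF this] have "(\<lambda>\<alpha>. c \<alpha> * pw x0 \<alpha>) summable_on UNIV"
    unfolding pw_def by (rule has_sum_imp_summable)
  then have "(\<lambda>\<alpha>. norm (c \<alpha> * pw x0 \<alpha>)) summable_on UNIV"
    by (rule summable_on_iff_abs_summable_on_real[THEN iffD1])
  moreover have pw0: "pw x0 \<alpha> > 0" for \<alpha>
    using \<rho> by (simp add: pw_def x0_def prod_pos)
  ultimately have c0: "(\<lambda>\<alpha>. \<bar>c \<alpha>\<bar> * pw x0 \<alpha>) summable_on UNIV"
    by (simp add: abs_mult less_imp_le)
  define Q where "Q = (\<Sum>\<^sub>\<infinity>\<alpha>. \<bar>c \<alpha>\<bar> * pw x0 \<alpha>)"
  obtain s0 where s0: "(1 / 2) ^ s0 < \<rho>"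
    using real_arch_pow_inv[OF \<rho>, of "1/2"] by auto
  have p0: "1 / real (p i) ^ s0 \<le> \<rho>" for i
  proof -
    have "(1 / real (p i)) ^ s0 \<le> (1 / 2) ^ s0"
      using prime_ge_2_nat[OF prime_p[of i]] by (intro power_mono divide_left_mono) auto
    then show ?thesis using s0 by (simp add: power_divide)
  qed
  have wt0: "wt s0 \<alpha> \<le> pw x0 \<alpha>" for \<alpha>
    unfolding wt_eq_prod pw_def x0_def using p0 by (intro prod_mono) (auto intro!: power_mono)
  define A0 where "A0 = {\<alpha> :: 'n \<Rightarrow> nat. \<alpha> last_index = 0}"
  define a where "a k \<alpha> = (if \<alpha> \<in> A0 then c (\<alpha>(last_index := k)) else 0)" for k \<alpha>
  have pwl: "pw (with_last y t) (\<alpha>(last_index := k)) = pw y \<alpha> * t ^ k" if "\<alpha> \<in> A0" for y t \<alpha> k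
    unfolding pw_def by (rule prod_with_last) (use that in \<open>simp add: A0_def\<close>)
  have x0l: "with_last x0 \<rho> = x0" by (simp add: with_last_def x0_def vec_eq_iff)
  \<comment> \<open>A Cauchy-type estimate: the terms with last exponent \<open>k\<close> of the
    convergent majorant at \<open>x0\<close> carry the common factor \<open>\<rho> ^ k\<close>, and
    together they are at most \<open>Q\<close>.\<close>
  have aQ: "sm s0 (a k) \<and> nrm s0 (a k) \<le> Q * (1 / \<rho>) ^ k" for k
  proof -
    let ?u = "\<lambda>\<alpha> :: 'n \<Rightarrow> nat. \<alpha>(last_index := k)"
    have inj: "inj_on ?u A0"
      by (auto simp: inj_on_def A0_def fun_eq_iff) metis
    have s: "(\<lambda>\<alpha>. \<bar>c \<alpha>\<bar> * pw x0 \<alpha>) summable_on (?u ` A0)"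
      by (rule summable_on_subset_banach[OF c0]) simp
    have "infsum (\<lambda>\<alpha>. \<bar>c \<alpha>\<bar> * pw x0 \<alpha>) (?u ` A0) \<le> Q"
      unfolding Q_def using s c0 less_imp_le[OF pw0] by (intro infsum_mono2) auto
    then have Q1: "infsum (\<lambda>\<alpha>. \<bar>c (?u \<alpha>)\<bar> * pw x0 (?u \<alpha>)) A0 \<le> Q"
      by (simp add: infsum_reindex[OF inj] o_def)
    have s1: "(\<lambda>\<alpha>. \<bar>c (?u \<alpha>)\<bar> * pw x0 (?u \<alpha>)) summable_on A0"
      using s by (simp add: summable_on_reindex[OF inj] o_def)
    let ?g = "\<lambda>\<alpha>. \<bar>a k \<alpha>\<bar> * pw x0 \<alpha>"
    have eq: "\<bar>c (?u \<alpha>)\<bar> * pw x0 (?u \<alpha>) * (1 / \<rho>) ^ k = ?g \<alpha>" if "\<alpha> \<in> A0" for \<alpha>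
      using pwl[OF that, of x0 \<rho> k] that \<rho> by (simp add: x0l a_def power_divide)
    have "((\<lambda>\<alpha>. \<bar>c (?u \<alpha>)\<bar> * pw x0 (?u \<alpha>) * (1 / \<rho>) ^ k) has_sum
        (infsum (\<lambda>\<alpha>. \<bar>c (?u \<alpha>)\<bar> * pw x0 (?u \<alpha>)) A0 * (1 / \<rho>) ^ k)) A0"
      using s1 by (intro has_sum_cmult_left has_sum_infsum)
    moreover have "((\<lambda>\<alpha>. \<bar>c (?u \<alpha>)\<bar> * pw x0 (?u \<alpha>) * (1 / \<rho>) ^ k) has_sum x) A0 \<longleftrightarrow>
        (?g has_sum x) UNIV" for x
      using eq by (intro has_sum_cong_neutral) (auto simp: a_def)
    ultimately have g: "(?g has_sum
        (infsum (\<lambda>\<alpha>. \<bar>c (?u \<alpha>)\<bar> * pw x0 (?u \<alpha>)) A0 * (1 / \<rho>) ^ k)) UNIV"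
      by simp
    have le: "\<bar>a k \<alpha>\<bar> * wt s0 \<alpha> \<le> ?g \<alpha>" for \<alpha>
      using wt0 by (intro mult_left_mono) auto
    have sm: "sm s0 (a k)"
      unfolding sm_def
      by (rule summable_on_comparison_test[OF has_sum_imp_summable[OF g]]) (use le in auto)
    have "nrm s0 (a k) \<le> infsum ?g UNIV"
      unfolding nrm_def using sm le has_sum_imp_summable[OF g]
      by (intro infsum_mono) (auto simp: sm_def)
    also have "\<dots> = infsum (\<lambda>\<alpha>. \<bar>c (?u \<alpha>)\<bar> * pw x0 (?u \<alpha>)) A0 * (1 / \<rho>) ^ k"
      using g by (rule infsumI)
    also have "\<dots> \<le> Q * (1 / \<rho>) ^ k"
      using Q1 \<rho> by (intro mult_right_mono) auto
    finally show ?thesis using sm by simp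
  qed
  have series: "(\<lambda>k. ev (a k) y * t ^ k) sums f (with_last y t)"
    if y: "y \<in> polydisc s0" and b: "with_last y t \<in> ball 0 r" for y t
  proof -
    let ?F = "\<lambda>(k, \<alpha>). c (\<alpha>(last_index := k)) * pw (with_last y t) (\<alpha>(last_index := k))"
    have "((\<lambda>\<alpha>. c \<alpha> * pw (with_last y t) \<alpha>) has_sum f (with_last y t)) UNIV"
      unfolding pw_def by (rule f[OF b])
    then have F: "(?F has_sum f (with_last y t)) (UNIV \<times> A0)"
      using has_sum_reindex_bij_betw[OF bij_betw_update_last,
          of "\<lambda>\<alpha>. c \<alpha> * pw (with_last y t) \<alpha>" "f (with_last y t)"]
      by (simp add: case_prod_beta' A0_def)
    have "((\<lambda>k. ev (a k) y * t ^ k) has_sum f (with_last y t)) UNIV"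
    proof (rule has_sum_SigmaD[OF F])
      fix k
      have "((\<lambda>\<alpha>. a k \<alpha> * pw y \<alpha> * t ^ k) has_sum (ev (a k) y * t ^ k)) UNIV"
        unfolding ev_def using aQ[of k] y by (intro has_sum_cmult_left has_sum_infsum ev_summable) auto
      moreover have "((\<lambda>\<alpha>. ?F (k, \<alpha>)) has_sum x) A0 \<longleftrightarrow>
          ((\<lambda>\<alpha>. a k \<alpha> * pw y \<alpha> * t ^ k) has_sum x) UNIV" for x
        using pwl by (intro has_sum_cong_neutral) (auto simp: a_def)
      ultimately show "((\<lambda>\<alpha>. ?F (k, \<alpha>)) has_sum (ev (a k) y * t ^ k)) A0"
        by simp
    qed
    then show ?thesis by (rule has_sum_imp_sums)
  qed
  define M where "M = 1 / \<rho>"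
  have M: "M > 0" using \<rho> by (simp add: M_def)
  \<comment> \<open>The family starts at index 1, because the coefficient of index 0 is merged with
    the threshold.\<close>
  have "nrm s0 (a (Suc k)) \<le> (Q * M) * M ^ k" for k
    using aQ[of "Suc k"] by (simp add: M_def mult.assoc)
  with Bautin_estimate[of s0 "\<lambda>k. a (Suc k)" "Q * M" M] aQ M
  obtain s d K where s: "s \<ge> s0" and K: "K > 0"
    and est: "\<And>k y. y \<in> polydisc s \<Longrightarrow>
      \<bar>ev (a (Suc k)) y\<bar> \<le> K * M ^ k * (\<Sum>j\<le>d. \<bar>ev (a (Suc j)) y\<bar>)"
    by blast
  obtain \<eta>0 where \<eta>0: "\<eta>0 > 0"
    and sub: "\<And>A s J. (\<And>k. \<bar>A (Suc k)\<bar> \<le> K * M ^ k * (\<Sum>i\<le>d. \<bar>A (Suc i)\<bar>)) \<Longrightarrow>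
      is_interval J \<Longrightarrow> J \<subseteq> {-\<eta>0<..<\<eta>0} \<Longrightarrow>
      union_of_at_most_intervals (d + 2) {t\<in>J. (\<Sum>n. A n * t ^ n) < s}"
    using sublevel_powser[OF K M, of d] by blast
  \<comment> \<open>Three demands: \<open>\<eta>0\<close> for the one-variable result,
    \<open>r / 2\<close> to keep \<open>with_last y t\<close> in the ball of convergence, and the
    radii to put \<open>y\<close> in the polydisc of the estimate.\<close>
  define \<eta> where "\<eta> = Min (insert \<eta>0 (insert (r / 2) (range (\<lambda>i. 1 / real (p i) ^ s))))"
  have "\<eta> \<in> insert \<eta>0 (insert (r / 2) (range (\<lambda>i. 1 / real (p i) ^ s)))"
    unfolding \<eta>_def by (rule Min_in) auto
  then have \<eta>: "\<eta> > 0" using \<eta>0 r prime_gt_0_nat[OF prime_p] by auto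
  have \<eta>le: "\<eta> \<le> \<eta>0" "\<eta> \<le> r / 2" "\<eta> \<le> 1 / real (p i) ^ s" for i
    unfolding \<eta>_def by (rule Min_le; simp)+
  have "union_of_at_most_intervals (d + 2) {t\<in>J. f (with_last y t) < v}"
    if y: "y \<in> base_ball \<eta>" and J: "is_interval J" "J \<subseteq> {-\<eta><..<\<eta>}" for y v J
  proof -
    have ys: "y \<in> polydisc s"
      unfolding polydisc_def
    proof (intro CollectI allI)
      fix i
      have "\<bar>y $ i\<bar> \<le> norm y" by (rule component_le_norm_cart)
      also have "\<dots> \<le> \<eta>" using y by (simp add: base_ball_def)
      also have "\<dots> \<le> 1 / real (p i) ^ s" by (rule \<eta>le)
      finally show "\<bar>y $ i\<bar> \<le> 1 / real (p i) ^ s" .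
    qed
    have eq: "f (with_last y t) = (\<Sum>n. ev (a n) y * t ^ n)" if "t \<in> J" for t
    proof (rule sums_unique[OF series])
      show "y \<in> polydisc s0" using ys polydisc_antimono[OF s] by blast
      have "t \<in> {-\<eta><..<\<eta>}" using that J by blast
      then have "norm (with_last y t) < 2 * \<eta>" by (intro norm_with_last_less[OF y]) auto
      then show "with_last y t \<in> ball 0 r" using \<eta>le(2) by simp
    qed
    have "{-\<eta><..<\<eta>} \<subseteq> {-\<eta>0<..<\<eta>0}" using \<eta>le(1) by auto
    then have "J \<subseteq> {-\<eta>0<..<\<eta>0}" using J(2) by blast
    from sub[of "\<lambda>n. ev (a n) y", OF est[OF ys] J(1) this]
    have "union_of_at_most_intervals (d + 2) {t\<in>J. (\<Sum>n. ev (a n) y * t ^ n) < v}" .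
    also have "{t\<in>J. (\<Sum>n. ev (a n) y * t ^ n) < v} = {t\<in>J. f (with_last y t) < v}"
      by (intro Collect_cong conj_cong refl) (simp only: eq)
    finally show ?thesis .
  qed
  then show ?thesis using \<eta> by blast
qed

theorem corollary2p1p2:
  fixes f :: "nat \<Rightarrow> real ^ 'n::{finite,linorder} \<Rightarrow> real"
    and U :: "nat \<Rightarrow> (real ^ 'n::{finite,linorder}) set"
    and l :: nat
  assumes "\<And>i. i \<in> {1..l} \<Longrightarrow> open (U i)"
    and "\<And>i. i \<in> {1..l} \<Longrightarrow> 0 \<in> U i"
    and "\<And>i. i \<in> {1..l} \<Longrightarrow> real_analytic_on (f i) (U i)"
    and "\<And>i. i \<in> {1..l} \<Longrightarrow> \<exists>x \<in> U i. f i x \<noteq> 0"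
  shows "\<exists>(\<eta>::real) (p::nat). \<eta> > 0 \<and> p > 0 \<and>
    (\<forall>i\<in>{1..l}. \<forall>y \<in> base_ball \<eta>. \<forall>t. \<bar>t\<bar> < \<eta> \<longrightarrow> with_last y t \<in> U i) \<and>
    (\<forall>s :: nat \<Rightarrow> real. \<forall>y \<in> base_ball \<eta>.
       union_of_at_most_intervals p
         {t. \<bar>t\<bar> < \<eta> \<and> (\<forall>i\<in>{1..l}. f i (with_last y t) < s i)})"
proof -
  have "\<forall>i\<in>{1..l}. \<exists>\<delta>. \<delta> > 0 \<and> ball 0 \<delta> \<subseteq> U i"
    using assms(1,2) open_contains_ball_eq by blast
  from bchoice[OF this] obtain \<delta> where \<delta>: "\<forall>i\<in>{1..l}. \<delta> i > 0 \<and> ball 0 (\<delta> i) \<subseteq> U i" ..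
  have "\<forall>i\<in>{1..l}. \<exists>\<eta> m. \<eta> > 0 \<and> (\<forall>y\<in>base_ball \<eta>. \<forall>s J. is_interval J \<longrightarrow> J \<subseteq> {-\<eta><..<\<eta>} \<longrightarrow>
    union_of_at_most_intervals m {t\<in>J. f i (with_last y t) < s})"
    using assms(2,3) by (intro ballI real_analytic_sublevel) (simp add: real_analytic_on_def)
  from bchoice[OF this] obtain h where "\<forall>i\<in>{1..l}. \<exists>m. h i > 0 \<and>
    (\<forall>y\<in>base_ball (h i). \<forall>s J. is_interval J \<longrightarrow> J \<subseteq> {-h i<..<h i} \<longrightarrow>
      union_of_at_most_intervals m {t\<in>J. f i (with_last y t) < s})" ..
  from bchoice[OF this] obtain m where h: "\<forall>i\<in>{1..l}. h i > 0 \<and>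
    (\<forall>y\<in>base_ball (h i). \<forall>s J. is_interval J \<longrightarrow> J \<subseteq> {-h i<..<h i} \<longrightarrow>
      union_of_at_most_intervals (m i) {t\<in>J. f i (with_last y t) < s})" ..
  \<comment> \<open>The element 1 keeps the set nonempty when \<open>l = 0\<close>.\<close>
  define \<eta> where "\<eta> = Min (insert 1 ((\<lambda>i. min (\<delta> i / 2) (h i)) ` {1..l}))"
  have "\<eta> \<in> insert 1 ((\<lambda>i. min (\<delta> i / 2) (h i)) ` {1..l})"
    unfolding \<eta>_def by (rule Min_in) auto
  then have \<eta>: "\<eta> > 0" using \<delta> h by auto
  have "\<eta> \<le> min (\<delta> i / 2) (h i)" if "i \<in> {1..l}" for i
    unfolding \<eta>_def by (rule Min_le) (use that in auto)
  then have \<eta>le: "2 * \<eta> \<le> \<delta> i" "\<eta> \<le> h i" if "i \<in> {1..l}" for i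
    using that by fastforce+
  \<comment> \<open>The maximum with 1 secures \<open>P > 0\<close>, as no positivity of the
    \<open>m i\<close> is recorded.\<close>
  define P where "P = max 1 (\<Prod>i\<in>{1..l}. m i)"
  have "with_last y t \<in> U i" if "i \<in> {1..l}" "y \<in> base_ball \<eta>" "\<bar>t\<bar> < \<eta>" for i y t
    using norm_with_last_less[OF that(2,3)] \<eta>le(1)[OF that(1)] \<delta> that(1)
    by (auto simp: subset_iff)
  moreover have "union_of_at_most_intervals P
      {t. \<bar>t\<bar> < \<eta> \<and> (\<forall>i\<in>{1..l}. f i (with_last y t) < s i)}" if y: "y \<in> base_ball \<eta>" for y s
  proof -
    define J where "J = {-\<eta><..<\<eta>}"
    have J: "is_interval J" by (simp add: J_def is_interval_oo)
    have "union_of_at_most_intervals (m i) {t\<in>J. f i (with_last y t) < s i}" if i: "i \<in> {1..l}" for i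
    proof -
      have "y \<in> base_ball (h i)" using y \<eta>le(2)[OF i] by (simp add: base_ball_def)
      moreover have "J \<subseteq> {-h i<..<h i}" using \<eta>le(2)[OF i] by (auto simp: J_def)
      ultimately show ?thesis using h i J by blast
    qed
    \<comment> \<open>The extra factor \<open>J\<close>, one interval, keeps the bound \<bar>t\<bar>
      < \<eta> when \<open>l = 0\<close>, where the intersection over \<open>i\<close> is all of the
      line.\<close>
    then have "union_of_at_most_intervals (1 * (\<Prod>i\<in>{1..l}. m i))
        (J \<inter> (\<Inter>i\<in>{1..l}. {t\<in>J. f i (with_last y t) < s i}))"
      using union_of_at_most_intervals_interval[OF J]
      by (intro union_of_at_most_intervals_Int union_of_at_most_intervals_INT) auto
    also have "J \<inter> (\<Inter>i\<in>{1..l}. {t\<in>J. f i (with_last y t) < s i}) =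
        {t. \<bar>t\<bar> < \<eta> \<and> (\<forall>i\<in>{1..l}. f i (with_last y t) < s i)}"
      by (auto simp: J_def)
    finally show ?thesis by (rule union_of_at_most_intervals_mono) (simp add: P_def)
  qed
  moreover have "P > 0" by (simp add: P_def)
  ultimately show ?thesis using \<eta> by blast
qed

end
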